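(* There is an integer linear programming (ILP) formulation for \textsc{Best Blue Response} with $\mathcal{O}(n^2\cdot k)$ binary variables, $\mathcal{O}(n)$ integer variables, and $\mathcal{O}(n^2\cdot k)$ constraints, where $n$ is the number of targets and $k$ is the number of sensors.
   Context: An Escape Sensing Game (ESG) consists of: a finite set of targets $T=\{t_1,\dots,t_n\}$, each $t_i$ with a value $v_i\in\mathbb{R}^+$; a finite set of sensors $S=\{s_1,\dots,s_k\}$; a recharging time $\tau\in\mathbb{N}\cup\{\infty\}$ common to all sensors; and a sensing matrix $D\in\{0,1\}^{n\times k}$, where $D_{i,j}=1$ means that sensor $s_j$ is capable of sensing target $t_i$. A target ordering is a bijection $\sigma:T\to[n]$. A sensing plan is a map $\psi:S\to 2^T$ with $\psi(s)\cap\psi(s')=\emptyset$ for all $s\neq s'\in S$. The plan $\psi$ is valid with respect to $\sigma$ if (i) for each $s_j\in S$ and $t_i\in\psi(s_j)$ we have $D_{i,j}=1$, and (ii) for each $s\in S$ and all distinct $t,t'\in\psi(s)$ we have $|\sigma(t)-\sigma(t')|>\tau$ (so if $\tau=\infty$ each sensor senses at most one target). The value of not-sensed targets is $v(\psi)=\sum_{t_i\in T\setminus\bigcup_{s\in S}\psi(s)}v_i$. Non-coordinated (greedy) sensing: the sensors have the fixed order $s_1,\dots,s_k$. Given $\sigma$, the target $\sigma^{-1}(i)$ passes sensor $s_j$ in step $i+j-1$, for $i\in[n]$, $j\in[k]$. The sensing plan $\psi_\sigma$ is built from the empty plan by going through the steps $\ell=1,\dots,n+k-1$: whenever target $t$ passes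 sensor $s_j$ in step $\ell$, add $t$ to $\psi_\sigma(s_j)$ if the resulting map is still a sensing plan (in particular $t$ has not been sensed before) that is valid with respect to $\sigma$. \textsc{Best Blue Response}: given an ESG with sensor order $s_1,\dots,s_k$, find a target ordering $\sigma$ maximizing $v(\psi_\sigma)$. That there is an ILP formulation of a given size means: from every instance one can construct in polynomial time an integer linear program (linear objective, linear constraints) of that size whose feasible solutions encode target orderings $\sigma$ (every ordering being encoded) with objective value equal to $v(\psi_\sigma)$; so its optimal solutions encode the solutions of the instance. *)

theory Defs
  imports Complex_Main "HOL-Library.Extended_Nat" "HOL-Library.Landau_Symbols"
begin

section \<open>Escape Sensing Games\<close>

text \<open>Targets and sensors are identified with their indices, so \<^term>\<open>i\<close> stands for
  $t_i$ and \<^term>\<open>j\<close> for $s_j$; the entries of the functions outside these ranges are irrelevant.\<close>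

record esg =
  num_targets :: nat
  num_sensors :: nat
  target_value :: "nat \<Rightarrow> real"
  recharge :: enat
  can_sense :: "nat \<Rightarrow> nat \<Rightarrow> bool"

definition targets :: "esg \<Rightarrow> nat set" where
  "targets G = {1..num_targets G}"

definition sensors :: "esg \<Rightarrow> nat set" where
  "sensors G = {1..num_sensors G}"

definition is_esg :: "esg \<Rightarrow> bool" where
  "is_esg G \<longleftrightarrow> num_targets G \<ge> 1 \<and> num_sensors G \<ge> 1 \<and> (\<forall>t \<in> targets G. target_value G t > 0)"

definition target_ordering :: "esg \<Rightarrow> (nat \<Rightarrow> nat) \<Rightarrow> bool" where
  "target_ordering G \<sigma> \<longleftrightarrow> bij_betw \<sigma> (targets G) {1..num_targets G}"

definition sensing_plan :: "esg \<Rightarrow> (nat \<Rightarrow> nat set) \<Rightarrow> bool" where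
  "sensing_plan G \<psi> \<longleftrightarrow>
     (\<forall>s \<in> sensors G. \<psi> s \<subseteq> targets G) \<and>
     (\<forall>s \<in> sensors G. \<forall>s' \<in> sensors G. s \<noteq> s' \<longrightarrow> \<psi> s \<inter> \<psi> s' = {})"

definition valid_plan :: "esg \<Rightarrow> (nat \<Rightarrow> nat) \<Rightarrow> (nat \<Rightarrow> nat set) \<Rightarrow> bool" where
  "valid_plan G \<sigma> \<psi> \<longleftrightarrow>
     (\<forall>s \<in> sensors G. \<forall>t \<in> \<psi> s. can_sense G t s) \<and>
     (\<forall>s \<in> sensors G. \<forall>t \<in> \<psi> s. \<forall>t' \<in> \<psi> s.
        t \<noteq> t' \<longrightarrow> enat (nat \<bar>int (\<sigma> t) - int (\<sigma> t')\<bar>) > recharge G)"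

definition plan_value :: "esg \<Rightarrow> (nat \<Rightarrow> nat set) \<Rightarrow> real" where
  "plan_value G \<psi> = (\<Sum>t \<in> targets G - (\<Union>s \<in> sensors G. \<psi> s). target_value G t)"

text \<open>The pairs (target, sensor) meeting in step \<^term>\<open>l\<close>. They involve pairwise different
  targets and pairwise different sensors, so the order in which they are listed does not matter.\<close>

definition passings :: "esg \<Rightarrow> (nat \<Rightarrow> nat) \<Rightarrow> nat \<Rightarrow> (nat \<times> nat) list" where
  "passings G \<sigma> l =
     [(inv_into (targets G) \<sigma> i, j).
        i \<leftarrow> [1..<num_targets G + 1], j \<leftarrow> [1..<num_sensors G + 1], i + j - 1 = l]"

definition greedy_add ::
  "esg \<Rightarrow> (nat \<Rightarrow> nat) \<Rightarrow> nat \<times> nat \<Rightarrow> (nat \<Rightarrow> nat set) \<Rightarrow> (nat \<Rightarrow> nat set)" where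
  "greedy_add G \<sigma> = (\<lambda>(t, s) \<psi>.
     let \<psi>' = \<psi>(s := insert t (\<psi> s))
     in if sensing_plan G \<psi>' \<and> valid_plan G \<sigma> \<psi>' then \<psi>' else \<psi>)"

definition greedy_plan :: "esg \<Rightarrow> (nat \<Rightarrow> nat) \<Rightarrow> (nat \<Rightarrow> nat set)" where
  "greedy_plan G \<sigma> =
     fold (greedy_add G \<sigma>) (concat (map (passings G \<sigma>) [1..<num_targets G + num_sensors G]))
       (\<lambda>_. {})"

definition best_blue_response :: "esg \<Rightarrow> (nat \<Rightarrow> nat) \<Rightarrow> bool" where
  "best_blue_response G \<sigma> \<longleftrightarrow>
     target_ordering G \<sigma> \<and>
     (\<forall>\<sigma>'. target_ordering G \<sigma>' \<longrightarrow>
        plan_value G (greedy_plan G \<sigma>') \<le> plan_value G (greedy_plan G \<sigma>))"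

section \<open>Integer linear programs\<close>

text \<open>A linear form $\sum_r c_r x_{j_r}$ is the list of its terms $(c_r, j_r)$. Variables
  \<open>0, \<dots>, num_integer - 1\<close> are integer and the following \<^term>\<open>num_binary\<close> ones are binary. A
  constraint \<^term>\<open>(a, b)\<close> reads $a(x) \le b$. The objective is to be maximized.\<close>

type_synonym 'c linear_form = "('c \<times> nat) list"

record ilp =
  num_integer :: nat
  num_binary :: nat
  objective :: "real linear_form"
  constraints :: "(int linear_form \<times> int) list"

definition num_vars :: "ilp \<Rightarrow> nat" where
  "num_vars I = num_integer I + num_binary I"

definition wf_ilp :: "ilp \<Rightarrow> bool" where
  "wf_ilp I \<longleftrightarrow>
     (\<forall>(c, j) \<in> set (objective I). j < num_vars I) \<and>
     (\<forall>(a, b) \<in> set (constraints I). \<forall>(c, j) \<in> set a. j < num_vars I)"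

definition objective_value :: "ilp \<Rightarrow> int list \<Rightarrow> real" where
  "objective_value I x = (\<Sum>(c, j) \<leftarrow> objective I. c * of_int (x ! j))"

definition feasible :: "ilp \<Rightarrow> int list \<Rightarrow> bool" where
  "feasible I x \<longleftrightarrow>
     length x = num_vars I \<and>
     (\<forall>j \<in> {num_integer I..<num_vars I}. x ! j \<in> {0, 1}) \<and>
     (\<forall>(a, b) \<in> set (constraints I). (\<Sum>(c, j) \<leftarrow> a. c * x ! j) \<le> b)"

definition optimal :: "ilp \<Rightarrow> int list \<Rightarrow> bool" where
  "optimal I x \<longleftrightarrow>
     feasible I x \<and> (\<forall>y. feasible I y \<longrightarrow> objective_value I y \<le> objective_value I x)"

section \<open>Polynomial-time computation\<close>

text \<open>Random access machines with unit costs whose only arithmetic operations are addition and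
  subtraction. After $t$ steps all integers have $O(t)$ more bits than those of the input, so
  that running times polynomial in the number of input cells are polynomial in the Turing machine
  sense as well; multiplication is left out because it would destroy this. Real numbers are opaque
  to the machine: they can only be copied. Hence the running time does not depend on how
  reals are represented.\<close>

datatype cell = Num int | Val real

fun num :: "cell \<Rightarrow> int" where
  "num (Num z) = z"
| "num (Val r) = 0"

datatype aexp = Const int | Mem aexp | Plus aexp aexp | Minus aexp aexp

fun aval :: "aexp \<Rightarrow> (int \<Rightarrow> cell) \<Rightarrow> int" where
  "aval (Const z) m = z"
| "aval (Mem a) m = num (m (aval a m))"
| "aval (Plus a b) m = aval a m + aval b m"
| "aval (Minus a b) m = aval a m - aval b m"

datatype com =
    Skip
  | Assign aexp aexp
  | Copy aexp aexp
  | Write aexp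
  | WriteCell aexp
  | Seq com com
  | IfPos aexp com com
  | WhilePos aexp com

text \<open>\<open>exec c (m, out) t (m', out')\<close>: started with memory \<^term>\<open>m\<close> and output tape
  \<^term>\<open>out\<close>, the program \<^term>\<open>c\<close> terminates after \<^term>\<open>t\<close> steps with \<^term>\<open>m'\<close> and
  \<^term>\<open>out'\<close>. An expression is evaluated in one step, as its size is fixed by the program.\<close>

inductive exec ::
  "com \<Rightarrow> (int \<Rightarrow> cell) \<times> cell list \<Rightarrow> nat \<Rightarrow> (int \<Rightarrow> cell) \<times> cell list \<Rightarrow> bool" where
  Skip: "exec Skip s 1 s"
| Assign: "exec (Assign a e) (m, out) 1 (m(aval a m := Num (aval e m)), out)"
| Copy: "exec (Copy a b) (m, out) 1 (m(aval a m := m (aval b m)), out)"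
| Write: "exec (Write e) (m, out) 1 (m, out @ [Num (aval e m)])"
| WriteCell: "exec (WriteCell a) (m, out) 1 (m, out @ [m (aval a m)])"
| Seq: "exec c1 s t1 s' \<Longrightarrow> exec c2 s' t2 s'' \<Longrightarrow> exec (Seq c1 c2) s (t1 + t2) s''"
| IfTrue: "aval e (fst s) > 0 \<Longrightarrow> exec c1 s t s' \<Longrightarrow> exec (IfPos e c1 c2) s (t + 1) s'"
| IfFalse: "aval e (fst s) \<le> 0 \<Longrightarrow> exec c2 s t s' \<Longrightarrow> exec (IfPos e c1 c2) s (t + 1) s'"
| WhileTrue: "aval e (fst s) > 0 \<Longrightarrow> exec c s t1 s' \<Longrightarrow> exec (WhilePos e c) s' t2 s'' \<Longrightarrow>
    exec (WhilePos e c) s (t1 + t2 + 1) s''"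
| WhileFalse: "aval e (fst s) \<le> 0 \<Longrightarrow> exec (WhilePos e c) s 1 s"

definition input_memory :: "cell list \<Rightarrow> int \<Rightarrow> cell" where
  "input_memory xs a = (if 0 \<le> a \<and> a < int (length xs) then xs ! nat a else Num 0)"

definition computes :: "com \<Rightarrow> cell list \<Rightarrow> cell list \<Rightarrow> nat \<Rightarrow> bool" where
  "computes P xs ys t \<longleftrightarrow> (\<exists>m. exec P (input_memory xs, []) t (m, ys))"

text \<open>One program maps the encoding \<open>enc x\<close> to \<open>res x\<close> for all \<open>x \<in> X\<close>.\<close>

definition poly_time_on :: "'a set \<Rightarrow> ('a \<Rightarrow> cell list) \<Rightarrow> ('a \<Rightarrow> cell list) \<Rightarrow> bool" where
  "poly_time_on X enc res \<longleftrightarrow>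
     (\<exists>P c d. \<forall>x \<in> X. \<exists>t \<le> c * length (enc x) ^ d + c. computes P (enc x) (res x) t)"

section \<open>Encodings\<close>

text \<open>The recharging time \<open>\<infinity>\<close> is represented by $-1$.\<close>

definition encode_esg :: "esg \<Rightarrow> cell list" where
  "encode_esg G =
     [Num (int (num_targets G)), Num (int (num_sensors G)),
      Num (case recharge G of enat r \<Rightarrow> int r | \<infinity> \<Rightarrow> -1)] @
     map (\<lambda>i. Val (target_value G i)) [1..<num_targets G + 1] @
     concat (map (\<lambda>i. map (\<lambda>j. Num (of_bool (can_sense G i j))) [1..<num_sensors G + 1])
       [1..<num_targets G + 1])"

definition encode_ordering :: "esg \<Rightarrow> (nat \<Rightarrow> nat) \<Rightarrow> cell list" where
  "encode_ordering G \<sigma> = map (\<lambda>i. Num (int (\<sigma> i))) [1..<num_targets G + 1]"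

text \<open>Lists are made self-delimiting: every element is preceded by 1 and the end is marked by 0.\<close>

definition encode_list :: "('a \<Rightarrow> cell list) \<Rightarrow> 'a list \<Rightarrow> cell list" where
  "encode_list f xs = concat (map (\<lambda>x. Num 1 # f x) xs) @ [Num 0]"

definition encode_ilp :: "ilp \<Rightarrow> cell list" where
  "encode_ilp I =
     [Num (int (num_integer I)), Num (int (num_binary I))] @
     encode_list (\<lambda>(c, j). [Val c, Num (int j)]) (objective I) @
     encode_list (\<lambda>(a, b). encode_list (\<lambda>(c, j). [Num c, Num (int j)]) a @ [Num b])
       (constraints I)"

lemma encode_list_inject:
  assumes f: "\<And>x y us vs. f x @ us = f y @ vs \<Longrightarrow> x = y \<and> us = vs"
  shows "encode_list f xs @ us = encode_list f ys @ vs \<Longrightarrow> xs = ys \<and> us = vs"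
proof (induction xs arbitrary: ys)
  case Nil
  then show ?case by (cases ys) (auto simp: encode_list_def)
next
  case (Cons x xs)
  then obtain y ys' where ys: "ys = y # ys'"
    by (cases ys) (auto simp: encode_list_def)
  have "f x @ (encode_list f xs @ us) = f y @ (encode_list f ys' @ vs)"
    using Cons.prems by (simp add: ys encode_list_def)
  from f[OF this] Cons.IH[of ys'] show ?case by (simp add: ys)
qed

lemma inj_encode_ilp: "inj encode_ilp"
proof (rule injI)
  fix I J :: ilp
  assume eq: "encode_ilp I = encode_ilp J"
  let ?t = "\<lambda>(c, j). [Val c, Num (int j)]"
  let ?u = "\<lambda>(c, j). [Num c, Num (int j)]"
  let ?r = "\<lambda>(a, b). encode_list ?u a @ [Num b]"
  have u: "x = y \<and> us = vs" if "?u x @ us = ?u y @ vs" for x y us vs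
    using that by (auto split: prod.splits)
  have r: "x = y \<and> us = vs" if "?r x @ us = ?r y @ vs" for x y us vs
    using that encode_list_inject[where f = ?u, OF u,
      of "fst x" "Num (snd x) # us" "fst y" "Num (snd y) # vs"]
    by (auto split: prod.splits simp: prod_eq_iff)
  have "objective I = objective J \<and>
      encode_list ?r (constraints I) = encode_list ?r (constraints J)"
    using eq by (intro encode_list_inject[where f = ?t])
      (auto simp: encode_ilp_def split: prod.splits)
  then have "objective I = objective J" "constraints I = constraints J"
    using encode_list_inject[where f = ?r and us = "[]" and vs = "[]", OF r] by auto
  with eq show "I = J" by (simp add: encode_ilp_def)
qed

section \<open>ILP formulations\<close>

text \<open>Feasible solutions of \<^term>\<open>I\<close> encode target orderings via \<open>dec\<close>. Orderings are
  compared on the targets only, as they are irrelevant elsewhere.\<close>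

definition formulates :: "ilp \<Rightarrow> (int list \<Rightarrow> nat \<Rightarrow> nat) \<Rightarrow> esg \<Rightarrow> bool" where
  "formulates I dec G \<longleftrightarrow>
     wf_ilp I \<and>
     (\<forall>x. feasible I x \<longrightarrow>
        target_ordering G (dec x) \<and>
        objective_value I x = plan_value G (greedy_plan G (dec x))) \<and>
     (\<forall>\<sigma>. target_ordering G \<sigma> \<longrightarrow>
        (\<exists>x. feasible I x \<and> (\<forall>t \<in> targets G. dec x t = \<sigma> t))) \<and>
     (\<forall>x. feasible I x \<longrightarrow> (optimal I x \<longleftrightarrow> best_blue_response G (dec x)))"

end

theory Submission imports Defs begin

text \<open>The greedy rule amounts to a recursion along the positions of an ordering and the sensors: the
  target at position $q$ is sensed by sensor $j$ iff $j$ is capable of sensing it, no earlier sensor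
  senses it, and $j$ senses no target at one of the $\tau$ positions before $q$. If a permutation
  matrix encodes the ordering, capability is a linear form in its entries, and the recursion becomes
  linear in binary variables: at each pair $(q, j)$ the value 1 excludes both kinds of obstacles, and
  if the target can be sensed, the value 0 requires one of them. So the matrix determines all other
  variables.

  For polynomial time, the program is printed by nested loops over targets and sensors. Such loop
  programs are compiled once and for all to random access machines.\<close>

section \<open>The greedy plan\<close>

text \<open>Pairs meet in the order of \<open>\<sigma> t + s - 1\<close>. When \<open>t\<close>
  meets \<open>s\<close>, only smaller sensors can already have sensed \<open>t\<close>, and
  whatever \<open>s\<close> has sensed stands before \<open>t\<close>. So the conditions of the rule
  can be read off the final plan, and the order of processing disappears.

  The objective has to be right at every feasible solution, not only at optimal ones, so each
  variable is forced from both sides. No large coefficients arise, since the obstacles are counted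
  by sums that are at most 1: a target has at most one sensor, and two targets sensed by the same
  sensor within a window of \<open>\<tau>\<close> positions would block each other. Using sums also
  matters for the size: one exclusion per position and pair of sensors would give about n k^2
  constraints, which is beyond the bound when k is much larger than n.

  On the machine the obstacle is the missing multiplication: variable indices such as n i + q are
  computed by repeated addition, with the number of rounds read from the input. This is affordable
  since n and k are at most the input length; for k the reason is that the sensing matrix has at
  least one row.\<close>

definition greedy_list :: "esg \<Rightarrow> (nat \<Rightarrow> nat) \<Rightarrow> (nat \<times> nat) list" where
  "greedy_list G \<sigma> = concat (map (passings G \<sigma>) [1..<num_targets G + num_sensors G])"

abbreviation greedy_fold :: "esg \<Rightarrow> (nat \<Rightarrow> nat) \<Rightarrow> (nat \<times> nat) list \<Rightarrow> nat \<Rightarrow> nat set" where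
  "greedy_fold G \<sigma> xs \<equiv> fold (greedy_add G \<sigma>) xs (\<lambda>_. {})"

lemma greedy_plan_eq_fold: "greedy_plan G \<sigma> = greedy_fold G \<sigma> (greedy_list G \<sigma>)"
  by (simp add: greedy_plan_def greedy_list_def)

lemma greedy_add_cases:
  "greedy_add G \<sigma> (t, s) \<psi> =
    (if sensing_plan G (\<psi>(s := insert t (\<psi> s))) \<and> valid_plan G \<sigma> (\<psi>(s := insert t (\<psi> s)))
     then \<psi>(s := insert t (\<psi> s)) else \<psi>)"
  by (simp add: greedy_add_def Let_def)

lemma greedy_add_incr: "\<psi> s \<subseteq> greedy_add G \<sigma> x \<psi> s"
  by (cases x) (auto simp: greedy_add_cases)

lemma fold_greedy_incr: "\<psi> s \<subseteq> fold (greedy_add G \<sigma>) xs \<psi> s"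
proof (induction xs arbitrary: \<psi>)
  case (Cons x xs)
  show ?case using greedy_add_incr[of \<psi> s G \<sigma> x] Cons[of "greedy_add G \<sigma> x \<psi>"] by auto
qed simp

text \<open>A sensor can hold only targets that have already met it; this converts membership in a
  partial plan into a bound on the step of the meeting.\<close>

lemma greedy_fold_subset: "greedy_fold G \<sigma> xs s \<subseteq> {t. (t, s) \<in> set xs}"
  by (induction xs rule: rev_induct) (auto simp: greedy_add_cases split: if_splits)

lemma greedy_fold_valid:
  "sensing_plan G (greedy_fold G \<sigma> xs) \<and> valid_plan G \<sigma> (greedy_fold G \<sigma> xs)"
proof (induction xs rule: rev_induct)
  case Nil
  show ?case by (simp add: sensing_plan_def valid_plan_def)
next
  case (snoc x xs)
  then show ?case by (cases x) (auto simp: greedy_add_cases)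
qed

lemma greedy_plan_sensing: "sensing_plan G (greedy_plan G \<sigma>)"
  and greedy_plan_valid: "valid_plan G \<sigma> (greedy_plan G \<sigma>)"
  unfolding greedy_plan_eq_fold using greedy_fold_valid by blast+

lemma mem_passings:
  assumes "target_ordering G \<sigma>"
  shows "(t, s) \<in> set (passings G \<sigma> l) \<longleftrightarrow> t \<in> targets G \<and> s \<in> sensors G \<and> \<sigma> t + s - 1 = l"
proof -
  from assms have bij: "bij_betw \<sigma> (targets G) {1..num_targets G}" by (simp add: target_ordering_def)
  have *: "(t, s) \<in> set (passings G \<sigma> l) \<longleftrightarrow>
    (\<exists>i \<in> {1..num_targets G}. s \<in> sensors G \<and> i + s - 1 = l \<and> t = inv_into (targets G) \<sigma> i)"
    unfolding passings_def sensors_def by force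
  show ?thesis unfolding * using bij_betw_inv_into_left[OF bij] bij_betw_inv_into_right[OF bij]
      bij_betwE[OF bij] bij_betwE[OF bij_betw_inv_into[OF bij]] by metis
qed

lemma mem_greedy_list:
  assumes "target_ordering G \<sigma>" "t \<in> targets G" "s \<in> sensors G"
  shows "(t, s) \<in> set (greedy_list G \<sigma>)"
proof -
  have "\<sigma> t \<in> {1..num_targets G}" using assms by (auto simp: target_ordering_def dest: bij_betwE)
  then have "\<sigma> t + s - 1 \<in> set [1..<num_targets G + num_sensors G]"
    using assms(3) by (auto simp: sensors_def)
  then show ?thesis using mem_passings[OF assms(1)] assms by (auto simp: greedy_list_def)
qed

text \<open>The non-strict order suffices: two pairs of equal rank that share their target or their
  sensor coincide.\<close>

lemma greedy_list_ordered:
  assumes "target_ordering G \<sigma>"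
  shows "sorted_wrt (\<lambda>(t, s) (t', s'). \<sigma> t + s - 1 \<le> \<sigma> t' + s' - 1) (greedy_list G \<sigma>)"
proof -
  let ?le = "\<lambda>(t, s) (t', s'). \<sigma> t + s - 1 \<le> \<sigma> t' + s' - (1 :: nat)"
  have "sorted_wrt ?le (concat (map (passings G \<sigma>) xs))" if "sorted xs" for xs
    using that
  proof (induction xs)
    case (Cons l xs)
    have step: "\<sigma> (fst x) + snd x - 1 = m" if "x \<in> set (passings G \<sigma> m)" for x m
      using that mem_passings[OF assms, of "fst x" "snd x" m] by simp
    then have "sorted_wrt ?le (passings G \<sigma> l)"
      by (simp add: sorted_wrt_iff_nth_less split_beta step[OF nth_mem] del: One_nat_def)
    moreover have "?le x y" if "x \<in> set (passings G \<sigma> l)" "y \<in> set (concat (map (passings G \<sigma>) xs))" for x y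
    proof -
      from that obtain m where "m \<in> set xs" "y \<in> set (passings G \<sigma> m)" by auto
      with step[OF that(1)] step[of y m] Cons.prems show ?thesis by (simp add: split_beta)
    qed
    ultimately show ?case using Cons by (auto simp: sorted_wrt_append)
  qed simp
  then show ?thesis by (simp add: greedy_list_def)
qed

text \<open>From left to right this is disjointness and validity of the final plan. From right to
  left, every obstacle that could be present when \<open>t\<close> meets \<open>s\<close> is among
  those that the right side excludes, because partial plans are contained in the final one and the
  earlier meetings involve smaller sensors or smaller positions.\<close>

lemma mem_greedy_plan_iff:
  assumes \<sigma>: "target_ordering G \<sigma>" and t: "t \<in> targets G" and s: "s \<in> sensors G"
  shows "t \<in> greedy_plan G \<sigma> s \<longleftrightarrow>
    can_sense G t s \<and> (\<forall>s' \<in> sensors G. s' < s \<longrightarrow> t \<notin> greedy_plan G \<sigma> s') \<and>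
    (\<forall>t' \<in> greedy_plan G \<sigma> s. \<sigma> t' < \<sigma> t \<longrightarrow> enat (\<sigma> t - \<sigma> t') > recharge G)"
    (is "_ \<longleftrightarrow> ?R")
proof
  assume ts: "t \<in> greedy_plan G \<sigma> s"
  have "can_sense G t s" using greedy_plan_valid[of G \<sigma>] s ts unfolding valid_plan_def by blast
  moreover have "t \<notin> greedy_plan G \<sigma> s'" if "s' \<in> sensors G" "s' < s" for s'
    using greedy_plan_sensing[of G \<sigma>] s ts that unfolding sensing_plan_def
    by (metis disjoint_iff less_irrefl)
  moreover have "enat (\<sigma> t - \<sigma> t') > recharge G" if "t' \<in> greedy_plan G \<sigma> s" "\<sigma> t' < \<sigma> t" for t'
  proof -
    have "enat (nat \<bar>int (\<sigma> t) - int (\<sigma> t')\<bar>) > recharge G"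
      using greedy_plan_valid[of G \<sigma>] s ts that unfolding valid_plan_def by (metis less_irrefl)
    moreover have "nat \<bar>int (\<sigma> t) - int (\<sigma> t')\<bar> = \<sigma> t - \<sigma> t'" using that by simp
    ultimately show ?thesis by (simp only:)
  qed
  ultimately show ?R by blast
next
  assume R: ?R
  \<comment> \<open>The run is cut at the meeting of \<open>t\<close> and \<open>s\<close>;
    \<open>\<psi>\<close> is the plan at that moment.\<close>
  from mem_greedy_list[OF assms] obtain xs ys where split: "greedy_list G \<sigma> = xs @ (t, s) # ys"
    by (meson split_list)
  define \<psi> where "\<psi> = greedy_fold G \<sigma> xs"
  have inj: "inj_on \<sigma> (targets G)" using \<sigma> by (simp add: target_ordering_def bij_betw_def)
  have step: "\<sigma> t' + s' - 1 \<le> \<sigma> t + s - 1" if "(t', s') \<in> set xs" for t' s'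
    using greedy_list_ordered[OF \<sigma>] that by (auto simp: split sorted_wrt_append)
  have final: "greedy_plan G \<sigma> = fold (greedy_add G \<sigma>) ys (greedy_add G \<sigma> (t, s) \<psi>)"
    by (simp add: greedy_plan_eq_fold split \<psi>_def)
  have sub: "\<psi> s' \<subseteq> greedy_plan G \<sigma> s'" for s'
    unfolding final using fold_greedy_incr[of "greedy_add G \<sigma> (t, s) \<psi>" s' G \<sigma> ys]
      greedy_add_incr[of \<psi> s' G \<sigma> "(t, s)"] by (rule order_trans[rotated])
  have sens: "sensing_plan G \<psi>" and val: "valid_plan G \<sigma> \<psi>"
    using greedy_fold_valid[of G \<sigma> xs] unfolding \<psi>_def by auto
  \<comment> \<open>Subtraction on \<open>nat\<close> truncates; with
    \<open>\<sigma> t \<ge> 1\<close> the comparison of steps does yield a comparison of sensors.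
    The bound \<open>s \<ge> 1\<close> serves positions in the same way in
    \<open>gap\<close>.\<close>
  have pos: "\<sigma> t \<ge> 1" using \<sigma> t by (auto simp: target_ordering_def dest: bij_betwE)
  have disj: "t \<notin> \<psi> s'" if s': "s' \<in> sensors G" "s' \<noteq> s" for s'
  proof
    assume "t \<in> \<psi> s'"
    then have "(t, s') \<in> set xs" using greedy_fold_subset[of G \<sigma> xs] unfolding \<psi>_def by blast
    from step[OF this] have "s' < s" using s' pos by simp
    with R s' sub \<open>t \<in> \<psi> s'\<close> show False by blast
  qed
  have gap: "\<sigma> t' < \<sigma> t \<and> enat (\<sigma> t - \<sigma> t') > recharge G" if t': "t' \<in> \<psi> s" "t' \<noteq> t" for t'
  proof -
    have "(t', s) \<in> set xs" using t' greedy_fold_subset[of G \<sigma> xs] unfolding \<psi>_def by blast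
    from step[OF this] have "\<sigma> t' \<le> \<sigma> t" using s by (auto simp: sensors_def)
    moreover have "\<sigma> t' \<noteq> \<sigma> t" using inj t t' sens s unfolding sensing_plan_def
      by (metis inj_onD subset_iff)
    ultimately show ?thesis using R sub t' by (meson le_neq_implies_less subsetD)
  qed
  have "sensing_plan G (\<psi>(s := insert t (\<psi> s)))"
    using sens t disj unfolding sensing_plan_def by auto
  moreover have "valid_plan G \<sigma> (\<psi>(s := insert t (\<psi> s)))"
  proof -
    \<comment> \<open>Validity quantifies over ordered pairs, so the new target occurs on either
      side of the difference.\<close>
    have "nat \<bar>int (\<sigma> t) - int (\<sigma> t')\<bar> = \<sigma> t - \<sigma> t'"
      "nat \<bar>int (\<sigma> t') - int (\<sigma> t)\<bar> = \<sigma> t - \<sigma> t'"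
      if "t' \<in> \<psi> s" "t' \<noteq> t" for t'
      using gap[OF that] by simp_all
    then show ?thesis
      using val R gap unfolding valid_plan_def by simp
  qed
  ultimately have "t \<in> greedy_add G \<sigma> (t, s) \<psi> s" by (simp add: greedy_add_cases)
  then show "t \<in> greedy_plan G \<sigma> s" unfolding final
    using fold_greedy_incr[of "greedy_add G \<sigma> (t, s) \<psi>" s G \<sigma> ys] by auto
qed

text \<open>A decoded ordering agrees with the one it encodes only on the targets; this makes the
  two interchangeable. The inverse in \<open>passings\<close> also searches only among
  targets.\<close>

lemma greedy_plan_cong:
  assumes "\<forall>t \<in> targets G. \<sigma> t = \<sigma>' t"
  shows "greedy_plan G \<sigma> = greedy_plan G \<sigma>'"
proof -
  have "inv_into (targets G) \<sigma> = inv_into (targets G) \<sigma>'"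
    unfolding inv_into_def using assms by (auto intro!: ext arg_cong[where f = Eps])
  then have "passings G \<sigma> = passings G \<sigma>'" by (intro ext) (simp only: passings_def)
  moreover have "sensing_plan G \<psi> \<and> valid_plan G \<sigma> \<psi> \<longleftrightarrow> sensing_plan G \<psi> \<and> valid_plan G \<sigma>' \<psi>" for \<psi>
    using assms unfolding sensing_plan_def valid_plan_def by (auto simp: subset_iff)
  then have "greedy_add G \<sigma> = greedy_add G \<sigma>'" by (auto simp: fun_eq_iff greedy_add_def Let_def)
  ultimately show ?thesis by (simp add: greedy_plan_def)
qed

section \<open>The integer linear program\<close>

text \<open>With 0-based indices, the integer variable \<open>position_var i\<close> is the position of target \<open>i\<close>,
  and binary variables express that target \<open>i\<close> is not sensed (\<open>missed_var\<close>), that target \<open>i\<close> is at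
  position \<open>q\<close> (\<open>place_var\<close>), and that the target at position \<open>q\<close> is sensed by sensor \<open>j\<close>
  (\<open>sense_var\<close>).\<close>

definition position_var :: "nat \<Rightarrow> nat" where
  "position_var i = i"

definition missed_var :: "esg \<Rightarrow> nat \<Rightarrow> nat" where
  "missed_var G i = num_targets G + i"

definition place_var :: "esg \<Rightarrow> nat \<Rightarrow> nat \<Rightarrow> nat" where
  "place_var G i q = num_targets G + num_targets G + (num_targets G * i + q)"

definition sense_var :: "esg \<Rightarrow> nat \<Rightarrow> nat \<Rightarrow> nat" where
  "sense_var G q j = num_targets G + num_targets G + num_targets G * num_targets G + (num_sensors G * q + j)"

text \<open>A sensor that senses at \<open>q'\<close> is still recharging at \<open>q\<close>. For
  an infinite recharging time, every earlier position blocks.\<close>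

definition blocks :: "esg \<Rightarrow> nat \<Rightarrow> nat \<Rightarrow> bool" where
  "blocks G q' q \<longleftrightarrow> q' < q \<and> enat (q - q') \<le> recharge G"

text \<open>The argument is a target in the row sums and in the position equation, but a position in
  the column sum and in the last constraint. Column sums need only an upper bound: it gives
  injectivity, and counting does the rest. The summand 1 in the coefficients accounts for positions
  starting at 1.\<close>

definition order_constraints :: "esg \<Rightarrow> nat \<Rightarrow> (int linear_form \<times> int) list" where
  "order_constraints G i = (let n = num_targets G; k = num_sensors G in
    [(map (\<lambda>q. (1, place_var G i q)) [0..<n], 1),
     (map (\<lambda>q. (- 1, place_var G i q)) [0..<n], - 1),
     (map (\<lambda>t. (1, place_var G t i)) [0..<n], 1),
     ((1, position_var i) # map (\<lambda>q. (- int q - 1, place_var G i q)) [0..<n], 0),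
     ((- 1, position_var i) # map (\<lambda>q. (int q + 1, place_var G i q)) [0..<n], 0),
     (map (\<lambda>j. (1, sense_var G i j)) [0..<k], 1)])"

text \<open>Let S be the sum over the sensors at \<open>q\<close>. If target \<open>i\<close> is
  placed at \<open>q\<close>, the two constraints say that the missed variable equals 1 - S.
  Otherwise they hold for any binary value, as S is 0 or 1.\<close>

definition missed_constraints :: "esg \<Rightarrow> nat \<Rightarrow> nat \<Rightarrow> (int linear_form \<times> int) list" where
  "missed_constraints G i q = (let k = num_sensors G in
    [((1, missed_var G i) # (1, place_var G i q) # map (\<lambda>j. (1, sense_var G q j)) [0..<k], 2),
     ((- 1, missed_var G i) # (1, place_var G i q) # map (\<lambda>j. (- 1, sense_var G q j)) [0..<k], 0)])"

text \<open>The first sum is the capability of sensor \<open>j\<close> for whichever target is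
  placed at \<open>q\<close>. Terms that do not apply get coefficient 0 instead of being dropped, so
  each sum runs over a full index range and can be printed by a plain loop.\<close>

definition sense_constraints :: "esg \<Rightarrow> nat \<Rightarrow> nat \<Rightarrow> (int linear_form \<times> int) list" where
  "sense_constraints G q j = (let n = num_targets G; k = num_sensors G in
    [((1, sense_var G q j) #
        map (\<lambda>i. (- of_bool (can_sense G (Suc i) (Suc j)), place_var G i q)) [0..<n], 0),
     ((1, sense_var G q j) # map (\<lambda>q'. (of_bool (blocks G q' q), sense_var G q' j)) [0..<n], 1),
     ((- 1, sense_var G q j) #
        map (\<lambda>i. (of_bool (can_sense G (Suc i) (Suc j)), place_var G i q)) [0..<n] @
        map (\<lambda>j'. (- of_bool (j' < j), sense_var G q j')) [0..<k] @
        map (\<lambda>q'. (- of_bool (blocks G q' q), sense_var G q' j)) [0..<n], 0)])"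

definition esg_ilp :: "esg \<Rightarrow> ilp" where
  "esg_ilp G = (let n = num_targets G; k = num_sensors G in
    \<lparr>num_integer = n,
     num_binary = n + n * n + k * n,
     objective = map (\<lambda>i. (target_value G (Suc i), missed_var G i)) [0..<n],
     constraints =
       concat (map (order_constraints G) [0..<n]) @
       concat (map (\<lambda>i. concat (map (missed_constraints G i) [0..<n])) [0..<n]) @
       concat (map (\<lambda>q. concat (map (sense_constraints G q) [0..<k])) [0..<n])\<rparr>)"

definition decode_ordering :: "int list \<Rightarrow> nat \<Rightarrow> nat" where
  "decode_ordering x t = nat (x ! position_var (t - 1))"

text \<open>The meaning of \<^term>\<open>feasible (esg_ilp G)\<close> for the position \<open>s i\<close> of target \<open>i\<close>, \<open>u i\<close> for
  missed, \<open>p i q\<close> for placed and \<open>y q j\<close> for sensed.\<close>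

definition esg_system :: "esg \<Rightarrow> (nat \<Rightarrow> int) \<Rightarrow> (nat \<Rightarrow> int) \<Rightarrow> (nat \<Rightarrow> nat \<Rightarrow> int) \<Rightarrow> (nat \<Rightarrow> nat \<Rightarrow> int) \<Rightarrow> bool"
where
  "esg_system G s u p y \<longleftrightarrow> (let n = num_targets G; k = num_sensors G in
    (\<forall>i < n. u i \<in> {0, 1} \<and> (\<forall>q < n. p i q \<in> {0, 1}) \<and> (\<forall>j < k. y i j \<in> {0, 1})) \<and>
    (\<forall>i < n. (\<Sum>q < n. p i q) = 1 \<and> (\<Sum>t < n. p t i) \<le> 1 \<and>
       s i = (\<Sum>q < n. (int q + 1) * p i q) \<and> (\<Sum>j < k. y i j) \<le> 1) \<and>
    (\<forall>i < n. \<forall>q < n. u i + p i q + (\<Sum>j < k. y q j) \<le> 2 \<and> p i q \<le> u i + (\<Sum>j < k. y q j)) \<and>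
    (\<forall>q < n. \<forall>j < k.
       y q j \<le> (\<Sum>i < n. of_bool (can_sense G (Suc i) (Suc j)) * p i q) \<and>
       y q j + (\<Sum>q' < n. of_bool (blocks G q' q) * y q' j) \<le> 1 \<and>
       (\<Sum>i < n. of_bool (can_sense G (Suc i) (Suc j)) * p i q) \<le>
         y q j + (\<Sum>j' < k. of_bool (j' < j) * y q j') + (\<Sum>q' < n. of_bool (blocks G q' q) * y q' j)))"

lemma sum_list_map_upt: "(\<Sum>i \<leftarrow> [0..<n]. f i) = (\<Sum>i < n. f i)"
  by (simp add: interv_sum_list_conv_sum_set_nat atLeast0LessThan)

lemma ball_concat_upt:
  "(\<forall>c \<in> set (concat (map f [0..<m])). P c) \<longleftrightarrow> (\<forall>i < m. \<forall>c \<in> set (f i). P c)"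
  by auto

lemma mult_add_less:
  fixes i j m k :: nat
  assumes "i < m" "j < k"
  shows "k * i + j < k * m"
proof -
  have "k * i + j < k * Suc i" using assms by simp
  also have "\<dots> \<le> k * m" using assms by (intro mult_le_mono2) simp
  finally show ?thesis .
qed

lemma esg_ilp_simps [simp]:
  "num_integer (esg_ilp G) = num_targets G"
  "num_binary (esg_ilp G) = num_targets G + num_targets G * num_targets G + num_sensors G * num_targets G"
  by (simp_all add: esg_ilp_def Let_def)

lemma num_vars_esg_ilp: "num_vars (esg_ilp G) =
    num_targets G + num_targets G + num_targets G * num_targets G + num_sensors G * num_targets G"
  by (simp add: num_vars_def)

lemma var_less:
  assumes "i < num_targets G"
  shows "position_var i < num_vars (esg_ilp G)" "missed_var G i < num_vars (esg_ilp G)"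
    "q < num_targets G \<Longrightarrow> place_var G i q < num_vars (esg_ilp G)"
    "j < num_sensors G \<Longrightarrow> sense_var G i j < num_vars (esg_ilp G)"
  using assms mult_add_less[of i "num_targets G" q "num_targets G"]
    mult_add_less[of i "num_targets G" j "num_sensors G"]
  by (auto simp: num_vars_esg_ilp position_var_def missed_var_def place_var_def sense_var_def)

lemma wf_esg_ilp: "wf_ilp (esg_ilp G)"
  unfolding wf_ilp_def
  by (auto simp: esg_ilp_def order_constraints_def missed_constraints_def sense_constraints_def Let_def
      simp flip: num_vars_esg_ilp intro!: var_less[unfolded esg_ilp_def Let_def])

lemma objective_value_esg_ilp:
  "objective_value (esg_ilp G) x = (\<Sum>i < num_targets G. target_value G (Suc i) * of_int (x ! missed_var G i))"
  by (simp add: objective_value_def esg_ilp_def Let_def comp_def sum_list_map_upt)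

text \<open>This leaves the list representation for good. The 0/1 condition by index implies the one
  by variable inside \<open>esg_system\<close>, because the variables are in range by
  \<open>var_less\<close>.\<close>

lemma feasible_esg_ilp_iff:
  "feasible (esg_ilp G) x \<longleftrightarrow> length x = num_vars (esg_ilp G) \<and>
     (\<forall>v \<in> {num_targets G..<num_vars (esg_ilp G)}. x ! v \<in> {0, 1}) \<and>
     esg_system G (\<lambda>i. x ! position_var i) (\<lambda>i. x ! missed_var G i)
       (\<lambda>i q. x ! place_var G i q) (\<lambda>q j. x ! sense_var G q j)"
proof -
  let ?n = "num_targets G" and ?k = "num_sensors G"
  let ?ok = "\<lambda>c. \<forall>(a, b) \<in> set c. (\<Sum>(c, j) \<leftarrow> a. c * x ! j) \<le> b"
  have order: "?ok (order_constraints G i) \<longleftrightarrow> (\<Sum>q < ?n. x ! place_var G i q) = 1 \<and>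
      (\<Sum>t < ?n. x ! place_var G t i) \<le> 1 \<and>
      x ! position_var i = (\<Sum>q < ?n. (int q + 1) * x ! place_var G i q) \<and>
      (\<Sum>j < ?k. x ! sense_var G i j) \<le> 1" for i
  proof -
    have "(\<Sum>q < ?n. (- int q - 1) * x ! place_var G i q) = - (\<Sum>q < ?n. (int q + 1) * x ! place_var G i q)"
      unfolding sum_negf[symmetric] by (intro sum.cong) (simp_all add: algebra_simps)
    then show ?thesis
      by (auto simp: order_constraints_def Let_def comp_def sum_list_map_upt sum_negf)
  qed
  have missed: "?ok (missed_constraints G i q) \<longleftrightarrow>
      x ! missed_var G i + x ! place_var G i q + (\<Sum>j < ?k. x ! sense_var G q j) \<le> 2 \<and>
      x ! place_var G i q \<le> x ! missed_var G i + (\<Sum>j < ?k. x ! sense_var G q j)" for i q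
    by (auto simp: missed_constraints_def Let_def comp_def sum_list_map_upt sum_negf)
  have sense: "?ok (sense_constraints G q j) \<longleftrightarrow>
       x ! sense_var G q j \<le> (\<Sum>i < ?n. of_bool (can_sense G (Suc i) (Suc j)) * x ! place_var G i q) \<and>
       x ! sense_var G q j + (\<Sum>q' < ?n. of_bool (blocks G q' q) * x ! sense_var G q' j) \<le> 1 \<and>
       (\<Sum>i < ?n. of_bool (can_sense G (Suc i) (Suc j)) * x ! place_var G i q) \<le>
         x ! sense_var G q j + (\<Sum>j' < ?k. of_bool (j' < j) * x ! sense_var G q j') +
         (\<Sum>q' < ?n. of_bool (blocks G q' q) * x ! sense_var G q' j)" for q j
    by (simp add: sense_constraints_def Let_def comp_def sum_list_map_upt sum_negf) linarith
  have con: "?ok (constraints (esg_ilp G)) \<longleftrightarrow>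
      (\<forall>i < ?n. ?ok (order_constraints G i)) \<and> (\<forall>i < ?n. \<forall>q < ?n. ?ok (missed_constraints G i q)) \<and>
      (\<forall>q < ?n. \<forall>j < ?k. ?ok (sense_constraints G q j))"
    unfolding esg_ilp_def Let_def by (simp only: ilp.simps set_append ball_Un ball_concat_upt)
  have bin: "\<forall>i < ?n. x ! missed_var G i \<in> {0, 1} \<and> (\<forall>q < ?n. x ! place_var G i q \<in> {0, 1}) \<and>
      (\<forall>j < ?k. x ! sense_var G i j \<in> {0, 1})"
    if "\<forall>v \<in> {?n..<num_vars (esg_ilp G)}. x ! v \<in> {0, 1}"
    using that var_less by (auto simp: missed_var_def place_var_def sense_var_def)
  show ?thesis
    unfolding feasible_def con order missed sense esg_system_def Let_def esg_ilp_simps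
    using bin by (auto simp: num_vars_def)
qed

definition solution :: "esg \<Rightarrow> (nat \<Rightarrow> int) \<Rightarrow> (nat \<Rightarrow> int) \<Rightarrow> (nat \<Rightarrow> nat \<Rightarrow> int) \<Rightarrow> (nat \<Rightarrow> nat \<Rightarrow> int) \<Rightarrow> int list"
where
  "solution G s u p y = (let n = num_targets G; k = num_sensors G in
     map s [0..<n] @ map u [0..<n] @ concat (map (\<lambda>i. map (p i) [0..<n]) [0..<n]) @
     concat (map (\<lambda>q. map (y q) [0..<k]) [0..<n]))"

lemma length_concat_map_upt: "length (concat (map (\<lambda>i. map (f i) [0..<k]) [0..<m])) = k * m"
  by (simp add: length_concat comp_def sum_list_triv)

lemma nth_concat_map_upt:
  assumes "i < m" "j < k"
  shows "concat (map (\<lambda>i. map (f i) [0..<k]) [0..<m]) ! (k * i + j) = f i j"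
  using assms(1)
proof (induction m)
  case (Suc m)
  show ?case
  proof (cases "i < m")
    case True
    then show ?thesis using Suc.IH mult_add_less[OF True assms(2)]
      by (simp add: nth_append length_concat_map_upt)
  next
    case False
    then show ?thesis using Suc.prems assms(2) by (simp add: nth_append length_concat_map_upt less_Suc_eq)
  qed
qed simp

text \<open>Every index of a binary variable points into the part of the list after the integer
  variables, all of whose entries are 0 or 1. Thus no index has to be split back into its
  coordinates.\<close>

lemma feasible_solution:
  assumes "esg_system G s u p y"
  shows "feasible (esg_ilp G) (solution G s u p y)"
    and "i < num_targets G \<Longrightarrow> solution G s u p y ! position_var i = s i"
proof -
  let ?n = "num_targets G" and ?k = "num_sensors G" and ?x = "solution G s u p y"
  let ?P = "concat (map (\<lambda>i. map (p i) [0..<?n]) [0..<?n])" and ?Y = "concat (map (\<lambda>q. map (y q) [0..<?k]) [0..<?n])"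
  have x: "?x = map s [0..<?n] @ map u [0..<?n] @ ?P @ ?Y"
    by (simp add: solution_def Let_def)
  have len: "length ?x = num_vars (esg_ilp G)"
    unfolding x num_vars_esg_ilp by (simp add: length_concat_map_upt)
  have s: "?x ! position_var i = s i" if "i < ?n" for i
    using that by (simp add: x nth_append position_var_def)
  have u: "?x ! missed_var G i = u i" if "i < ?n" for i
    using that by (simp add: x nth_append missed_var_def)
  have p: "?x ! place_var G i q = p i q" if "i < ?n" "q < ?n" for i q
  proof -
    have "?x ! place_var G i q = ?P ! (?n * i + q)"
      using mult_add_less[OF that] by (simp add: x nth_append place_var_def length_concat_map_upt)
    then show ?thesis using that by (simp add: nth_concat_map_upt)
  qed
  have y: "?x ! sense_var G q j = y q j" if "q < ?n" "j < ?k" for q j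
  proof -
    have "?x ! sense_var G q j = ?Y ! (?k * q + j)"
      by (simp add: x nth_append sense_var_def length_concat_map_upt)
    then show ?thesis using that by (simp add: nth_concat_map_upt)
  qed
  have "\<And>i. i < ?n \<Longrightarrow> u i \<in> {0, 1}" "\<And>i q. i < ?n \<Longrightarrow> q < ?n \<Longrightarrow> p i q \<in> {0, 1}"
    "\<And>q j. q < ?n \<Longrightarrow> j < ?k \<Longrightarrow> y q j \<in> {0, 1}"
    using assms unfolding esg_system_def Let_def by blast+
  then have "set (map u [0..<?n] @ ?P @ ?Y) \<subseteq> {0, 1}"
    by (fastforce simp del: insert_iff)
  moreover have "?x ! v \<in> set (map u [0..<?n] @ ?P @ ?Y)" if "v \<in> {?n..<num_vars (esg_ilp G)}" for v
  proof -
    have "?x ! v = (map u [0..<?n] @ ?P @ ?Y) ! (v - ?n)"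
      unfolding x using that by (subst nth_append) simp
    moreover have "v - ?n < length (map u [0..<?n] @ ?P @ ?Y)"
      using that len unfolding x by auto
    ultimately show ?thesis using nth_mem by metis
  qed
  moreover have "esg_system G (\<lambda>i. ?x ! position_var i) (\<lambda>i. ?x ! missed_var G i)
       (\<lambda>i q. ?x ! place_var G i q) (\<lambda>q j. ?x ! sense_var G q j) = esg_system G s u p y"
    unfolding esg_system_def Let_def by (simp add: s u p y cong: sum.cong_simp)
  ultimately show "feasible (esg_ilp G) ?x"
    unfolding feasible_esg_ilp_iff using len assms by blast
  show "i < num_targets G \<Longrightarrow> ?x ! position_var i = s i" by (rule s)
qed

section \<open>Solutions and orderings\<close>

lemma one_hot:
  fixes z :: "nat \<Rightarrow> int"
  assumes bin: "\<And>q. q < n \<Longrightarrow> z q \<in> {0, 1}" and sum: "(\<Sum>q < n. z q) = 1"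
  shows "\<exists>q < n. \<forall>q' < n. z q' = of_bool (q' = q)"
proof -
  have "\<exists>q < n. z q \<noteq> 0"
  proof (rule ccontr)
    assume "\<not> ?thesis"
    then have "(\<Sum>q < n. z q) = 0" by simp
    with sum show False by simp
  qed
  then obtain q where q: "q < n" "z q = 1" using bin by blast
  have "(\<Sum>q' \<in> {..<n} - {q}. z q') = 0"
    using sum q sum.remove[of "{..<n}" q z] by simp
  moreover have "\<forall>q' \<in> {..<n} - {q}. 0 \<le> z q'" using bin by fastforce
  ultimately have "\<forall>q' \<in> {..<n} - {q}. z q' = 0"
    by (subst (asm) sum_nonneg_eq_0_iff) auto
  with q show ?thesis by auto
qed

lemma sum_of_bool_le_1:
  assumes "finite A" "\<And>x y. x \<in> A \<Longrightarrow> y \<in> A \<Longrightarrow> P x \<Longrightarrow> P y \<Longrightarrow> x = y"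
  shows "(\<Sum>x \<in> A. of_bool (P x)) \<le> (1 :: int)"
proof -
  have "card {x \<in> A. P x} \<le> Suc 0"
    using assms by (subst card_le_Suc0_iff_eq) auto
  then show ?thesis using assms(1) by (simp add: sum.If_cases of_bool_def Int_def)
qed

lemma member_le_sum_lessThan:
  fixes z :: "nat \<Rightarrow> int"
  assumes "a < n" "\<And>q. q < n \<Longrightarrow> 0 \<le> z q"
  shows "z a \<le> (\<Sum>q < n. z q)"
  using assms by (intro member_le_sum) auto

lemma pair_le_sum_lessThan:
  fixes z :: "nat \<Rightarrow> int"
  assumes "a < n" "b < n" "a \<noteq> b" "\<And>q. q < n \<Longrightarrow> 0 \<le> z q"
  shows "z a + z b \<le> (\<Sum>q < n. z q)"
proof -
  have "z a + z b = (\<Sum>q \<in> {a, b}. z q)" using assms by simp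
  also have "\<dots> \<le> (\<Sum>q < n. z q)" using assms by (intro sum_mono2) auto
  finally show ?thesis .
qed

definition target_at :: "esg \<Rightarrow> (nat \<Rightarrow> nat) \<Rightarrow> nat \<Rightarrow> nat" where
  "target_at G \<sigma> q = inv_into (targets G) \<sigma> (Suc q)"

definition sensed_at :: "esg \<Rightarrow> (nat \<Rightarrow> nat) \<Rightarrow> nat \<Rightarrow> nat \<Rightarrow> bool" where
  "sensed_at G \<sigma> q j \<longleftrightarrow> target_at G \<sigma> q \<in> greedy_plan G \<sigma> (Suc j)"

context
  fixes G \<sigma>
  assumes \<sigma>: "target_ordering G \<sigma>"
begin

lemma target_at:
  assumes "q < num_targets G"
  shows "target_at G \<sigma> q \<in> targets G" "\<sigma> (target_at G \<sigma> q) = Suc q"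
proof -
  have "bij_betw \<sigma> (targets G) {1..num_targets G}" using \<sigma> by (simp add: target_ordering_def)
  moreover have "Suc q \<in> {1..num_targets G}" using assms by simp
  ultimately show "target_at G \<sigma> q \<in> targets G" "\<sigma> (target_at G \<sigma> q) = Suc q"
    unfolding target_at_def by (metis bij_betw_imp_surj_on inv_into_into f_inv_into_f)+
qed

lemma ordering_range: "t \<in> targets G \<Longrightarrow> 1 \<le> \<sigma> t \<and> \<sigma> t \<le> num_targets G"
  using \<sigma> by (auto simp: target_ordering_def dest: bij_betwE)

lemma ordering_eq_iff: "t \<in> targets G \<Longrightarrow> t' \<in> targets G \<Longrightarrow> \<sigma> t = \<sigma> t' \<longleftrightarrow> t = t'"
  using \<sigma> by (auto simp: target_ordering_def bij_betw_def dest: inj_onD)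

lemma target_at_ordering: "t \<in> targets G \<Longrightarrow> target_at G \<sigma> (\<sigma> t - 1) = t"
proof -
  assume t: "t \<in> targets G"
  from ordering_range[OF this] have "\<sigma> t - 1 < num_targets G" "Suc (\<sigma> t - 1) = \<sigma> t" by auto
  with target_at[of "\<sigma> t - 1"] show ?thesis using ordering_eq_iff[OF _ t] by simp
qed

text \<open>The right side refers only to pairs with smaller \<open>q + j\<close>, so the
  equivalence determines \<open>sensed_at\<close> recursively. It is the only fact about the greedy
  rule that the comparison with the sensing constraints uses.\<close>

lemma sensed_at_iff:
  assumes q: "q < num_targets G" and j: "j < num_sensors G"
  shows "sensed_at G \<sigma> q j \<longleftrightarrow> can_sense G (target_at G \<sigma> q) (Suc j) \<and>
    (\<forall>j' < j. \<not> sensed_at G \<sigma> q j') \<and> (\<forall>q' < num_targets G. blocks G q' q \<longrightarrow> \<not> sensed_at G \<sigma> q' j)"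
proof -
  have js: "Suc j \<in> sensors G" using j by (simp add: sensors_def)
  have "(\<forall>s \<in> sensors G. s < Suc j \<longrightarrow> target_at G \<sigma> q \<notin> greedy_plan G \<sigma> s) \<longleftrightarrow>
      (\<forall>j' < j. \<not> sensed_at G \<sigma> q j')" (is "?l \<longleftrightarrow> ?r")
  proof
    assume ?l
    with j show ?r by (auto simp: sensed_at_def sensors_def)
  next
    assume r: ?r
    show ?l
    proof (intro ballI impI)
      fix s
      assume "s \<in> sensors G" "s < Suc j"
      then have "s - 1 < j" "Suc (s - 1) = s" by (auto simp: sensors_def)
      with r show "target_at G \<sigma> q \<notin> greedy_plan G \<sigma> s" unfolding sensed_at_def by metis
    qed
  qed
  moreover have "(\<forall>t \<in> greedy_plan G \<sigma> (Suc j). \<sigma> t < \<sigma> (target_at G \<sigma> q) \<longrightarrow>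
        enat (\<sigma> (target_at G \<sigma> q) - \<sigma> t) > recharge G) \<longleftrightarrow>
      (\<forall>q' < num_targets G. blocks G q' q \<longrightarrow> \<not> sensed_at G \<sigma> q' j)" (is "?l \<longleftrightarrow> ?r")
  proof
    assume l: ?l
    show ?r
    proof (intro allI impI notI)
      fix q'
      assume "q' < num_targets G" "blocks G q' q" "sensed_at G \<sigma> q' j"
      with l show False using target_at(2)[OF q] target_at(2)[of q']
        by (fastforce simp: blocks_def sensed_at_def)
    qed
  next
    assume r: ?r
    show ?l
    proof (intro ballI impI)
      fix t
      assume t: "t \<in> greedy_plan G \<sigma> (Suc j)" "\<sigma> t < \<sigma> (target_at G \<sigma> q)"
      then have "t \<in> targets G" using greedy_plan_sensing[of G \<sigma>] js unfolding sensing_plan_def by blast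
      note range = ordering_range[OF this] and at = target_at_ordering[OF this]
      have "sensed_at G \<sigma> (\<sigma> t - 1) j" using t(1) at by (simp add: sensed_at_def)
      with r range have "\<not> blocks G (\<sigma> t - 1) q" by fastforce
      \<comment> \<open>Both positions are shifted by one, so their distance is unchanged.\<close>
      moreover have "\<sigma> t - 1 < q" "q - (\<sigma> t - 1) = Suc q - \<sigma> t"
        using t(2) range target_at(2)[OF q] by auto
      ultimately show "enat (\<sigma> (target_at G \<sigma> q) - \<sigma> t) > recharge G"
        using target_at(2)[OF q] by (simp add: blocks_def not_le)
    qed
  qed
  ultimately show ?thesis
    unfolding sensed_at_def[of G \<sigma> q j] mem_greedy_plan_iff[OF \<sigma> target_at(1)[OF q] js] by simp
qed

lemma sensed_at_unique_sensor:
  assumes "q < num_targets G" "j < num_sensors G" "j' < num_sensors G"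
    "sensed_at G \<sigma> q j" "sensed_at G \<sigma> q j'"
  shows "j = j'"
  using assms sensed_at_iff[of q j] sensed_at_iff[of q j'] by (cases j j' rule: linorder_cases) auto

text \<open>Column \<open>q\<close> of the permutation matrix has its only 1 at the target placed
  there, so just one coefficient survives.\<close>

lemma can_sense_target_at:
  assumes "q < num_targets G"
  shows "(\<Sum>i < num_targets G. of_bool (can_sense G (Suc i) s) * of_bool (\<sigma> (Suc i) = Suc q)) =
    (of_bool (can_sense G (target_at G \<sigma> q) s) :: int)"
proof -
  let ?i = "target_at G \<sigma> q - 1"
  have i: "?i < num_targets G" "Suc ?i = target_at G \<sigma> q"
    using target_at(1)[OF assms] by (auto simp: targets_def)
  have "\<sigma> (Suc i) = Suc q \<longleftrightarrow> i = ?i" if "i < num_targets G" for i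
    using ordering_eq_iff[of "Suc i" "target_at G \<sigma> q"] target_at[OF assms] that i by (auto simp: targets_def)
  then have "(\<Sum>i < num_targets G. of_bool (can_sense G (Suc i) s) * of_bool (\<sigma> (Suc i) = Suc q)) =
      (\<Sum>i < num_targets G. if i = ?i then of_bool (can_sense G (Suc i) s) else (0 :: int))"
    by (intro sum.cong) auto
  also have "\<dots> = of_bool (can_sense G (target_at G \<sigma> q) s)"
    using i by simp
  finally show ?thesis .
qed

lemma plan_value_eq:
  "plan_value G (greedy_plan G \<sigma>) =
    (\<Sum>i < num_targets G. target_value G (Suc i) *
       of_bool (\<forall>j < num_sensors G. \<not> sensed_at G \<sigma> (\<sigma> (Suc i) - 1) j))"
proof -
  have sens: "(\<Union>s \<in> sensors G. greedy_plan G \<sigma> s) = (\<Union>j < num_sensors G. greedy_plan G \<sigma> (Suc j))"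
  proof -
    have "sensors G = Suc ` {..<num_sensors G}"
      unfolding sensors_def by (simp add: image_Suc_lessThan)
    then show ?thesis by simp
  qed
  have "sensed_at G \<sigma> (\<sigma> t - 1) j \<longleftrightarrow> t \<in> greedy_plan G \<sigma> (Suc j)" if "t \<in> targets G" for t j
    using target_at_ordering[OF that] by (simp add: sensed_at_def)
  then have "plan_value G (greedy_plan G \<sigma>) = (\<Sum>t \<in> targets G. target_value G t *
       of_bool (\<forall>j < num_sensors G. \<not> sensed_at G \<sigma> (\<sigma> t - 1) j))"
    unfolding plan_value_def sens by (intro sum.mono_neutral_cong_left) (auto simp: targets_def)
  also have "targets G = Suc ` {..<num_targets G}"
    unfolding targets_def by (simp add: image_Suc_lessThan)
  finally show ?thesis unfolding sum.reindex[OF inj_Suc] comp_def .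
qed

section \<open>From orderings to solutions\<close>

lemma esg_system_ordering:
  "esg_system G (\<lambda>i. int (\<sigma> (Suc i)))
    (\<lambda>i. of_bool (\<forall>j < num_sensors G. \<not> sensed_at G \<sigma> (\<sigma> (Suc i) - 1) j))
    (\<lambda>i q. of_bool (\<sigma> (Suc i) = Suc q)) (\<lambda>q j. of_bool (sensed_at G \<sigma> q j))"
proof -
  let ?n = "num_targets G" and ?k = "num_sensors G"
  have tgt: "Suc i \<in> targets G" if "i < ?n" for i using that by (simp add: targets_def)
  have pos: "\<sigma> (Suc i) - 1 < ?n" "Suc (\<sigma> (Suc i) - 1) = \<sigma> (Suc i)" if "i < ?n" for i
    using ordering_range[OF tgt[OF that]] by auto
  have place: "(\<Sum>q < ?n. f q * of_bool (\<sigma> (Suc i) = Suc q)) = f (\<sigma> (Suc i) - 1)"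
    if "i < ?n" for i and f :: "nat \<Rightarrow> int"
  proof -
    have "(\<Sum>q < ?n. f q * of_bool (\<sigma> (Suc i) = Suc q)) = (\<Sum>q < ?n. if q = \<sigma> (Suc i) - 1 then f q else 0)"
      using pos[OF that] by (intro sum.cong) auto
    then show ?thesis using pos[OF that] by simp
  qed
  have b01: "(of_bool P :: int) \<in> {0, 1}" for P by (cases P) simp_all
  have one: "(\<Sum>q < ?n. of_bool (\<sigma> (Suc i) = Suc q)) = (1 :: int)" if "i < ?n" for i
    using place[OF that, of "\<lambda>_. 1"] by simp
  have col: "(\<Sum>t < ?n. of_bool (\<sigma> (Suc t) = Suc q)) \<le> (1 :: int)" for q
    using ordering_eq_iff[OF tgt tgt] by (intro sum_of_bool_le_1) (auto, metis Suc_inject)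
  have row: "(\<Sum>j < ?k. of_bool (sensed_at G \<sigma> q j)) \<le> (1 :: int)" if "q < ?n" for q
    using sensed_at_unique_sensor[OF that] by (intro sum_of_bool_le_1) auto
  have sum0: "(\<Sum>j < ?k. of_bool (sensed_at G \<sigma> q j)) = (0 :: int)"
    if "\<forall>j < ?k. \<not> sensed_at G \<sigma> q j" for q using that by simp
  have sum1: "(\<Sum>j < ?k. of_bool (sensed_at G \<sigma> q j)) \<ge> (1 :: int)"
    if "\<not> (\<forall>j < ?k. \<not> sensed_at G \<sigma> q j)" for q
  proof -
    from that obtain j where j: "j < ?k" "sensed_at G \<sigma> q j" by blast
    then show ?thesis using member_le_sum_lessThan[of j ?k "\<lambda>j. of_bool (sensed_at G \<sigma> q j)"] by simp
  qed
  have window: "of_bool (sensed_at G \<sigma> q j) +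
      (\<Sum>q' < ?n. of_bool (blocks G q' q) * of_bool (sensed_at G \<sigma> q' j)) \<le> (1 :: int)"
    if q: "q < ?n" and j: "j < ?k" for q j
  proof (cases "sensed_at G \<sigma> q j")
    case True
    then have "(\<Sum>q' < ?n. of_bool (blocks G q' q) * of_bool (sensed_at G \<sigma> q' j)) = (0 :: int)"
      using sensed_at_iff[OF q j] by (intro sum.neutral) auto
    then show ?thesis by simp
  next
    case False
    \<comment> \<open>The recursion at \<open>q\<close> does not limit the number of blocking
      positions. The recursion at the later of two such positions does: their distance is at most
      the distance of the earlier one to \<open>q\<close>, so the earlier one blocks it.\<close>
    have no: False if "q1 < q2" "q2 < ?n" "blocks G q1 q" "blocks G q2 q" "sensed_at G \<sigma> q1 j"
      "sensed_at G \<sigma> q2 j" for q1 q2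
    proof -
      have "enat (q2 - q1) \<le> enat (q - q1)" using that by (auto simp: blocks_def)
      also have "\<dots> \<le> recharge G" using that by (simp add: blocks_def)
      finally have "blocks G q1 q2" using that by (simp add: blocks_def)
      with sensed_at_iff[OF that(2) j] that show False by auto
    qed
    have "(\<Sum>q' < ?n. of_bool (blocks G q' q \<and> sensed_at G \<sigma> q' j)) \<le> (1 :: int)"
    proof (intro sum_of_bool_le_1)
      fix a b
      assume "a \<in> {..<?n}" "b \<in> {..<?n}" "blocks G a q \<and> sensed_at G \<sigma> a j" "blocks G b q \<and> sensed_at G \<sigma> b j"
      then show "a = b" using no[of a b] no[of b a] by (cases a b rule: linorder_cases) auto
    qed simp
    with False show ?thesis by (simp only: of_bool_conj) simp
  qed
  have lower: "of_bool (can_sense G (target_at G \<sigma> q) (Suc j)) \<le> of_bool (sensed_at G \<sigma> q j) +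
      (\<Sum>j' < ?k. of_bool (j' < j) * of_bool (sensed_at G \<sigma> q j')) +
      (\<Sum>q' < ?n. of_bool (blocks G q' q) * of_bool (sensed_at G \<sigma> q' j) :: int)" (is "_ \<le> _ + ?S1 + ?S2")
    if q: "q < ?n" and j: "j < ?k" for q j
  proof -
    have nonneg: "0 \<le> ?S1" "0 \<le> ?S2" by (intro sum_nonneg; simp)+
    \<comment> \<open>If the target can be sensed but is not, the recursion supplies an obstacle,
      which is a term equal to 1 in one of the two sums.\<close>
    consider "sensed_at G \<sigma> q j" | "\<not> can_sense G (target_at G \<sigma> q) (Suc j)"
      | j' where "j' < j" "sensed_at G \<sigma> q j'"
      | q' where "q' < ?n" "blocks G q' q" "sensed_at G \<sigma> q' j"
      using sensed_at_iff[OF q j] by blast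
    then show ?thesis
    proof cases
      case 3
      then have "1 \<le> ?S1"
        using member_le_sum_lessThan[of j' ?k "\<lambda>j'. of_bool (j' < j) * of_bool (sensed_at G \<sigma> q j')"] j by simp
      with nonneg show ?thesis by (auto simp: of_bool_def)
    next
      case 4
      then have "1 \<le> ?S2"
        using member_le_sum_lessThan[of q' ?n "\<lambda>q'. of_bool (blocks G q' q) * of_bool (sensed_at G \<sigma> q' j)"] by simp
      with nonneg show ?thesis by (auto simp: of_bool_def)
    qed (use nonneg in \<open>auto simp: of_bool_def\<close>)
  qed
  have upper: "of_bool (sensed_at G \<sigma> q j) \<le> (of_bool (can_sense G (target_at G \<sigma> q) (Suc j)) :: int)"
    if "q < ?n" "j < ?k" for q j
    using sensed_at_iff[OF that] by auto
  have missed: "of_bool (\<forall>j < ?k. \<not> sensed_at G \<sigma> (\<sigma> (Suc i) - 1) j) + of_bool (\<sigma> (Suc i) = Suc q) +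
        (\<Sum>j < ?k. of_bool (sensed_at G \<sigma> q j)) \<le> (2 :: int)"
      "of_bool (\<sigma> (Suc i) = Suc q) \<le> of_bool (\<forall>j < ?k. \<not> sensed_at G \<sigma> (\<sigma> (Suc i) - 1) j) +
        (\<Sum>j < ?k. of_bool (sensed_at G \<sigma> q j) :: int)"
    if i: "i < ?n" and q: "q < ?n" for i q
  proof -
    let ?S = "\<Sum>j < ?k. of_bool (sensed_at G \<sigma> q j) :: int"
    have S: "0 \<le> ?S" by (intro sum_nonneg) simp
    have "\<sigma> (Suc i) - 1 = q" if "\<sigma> (Suc i) = Suc q" using that by simp
    then show "of_bool (\<forall>j < ?k. \<not> sensed_at G \<sigma> (\<sigma> (Suc i) - 1) j) + of_bool (\<sigma> (Suc i) = Suc q) + ?S \<le> 2"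
      "of_bool (\<sigma> (Suc i) = Suc q) \<le> of_bool (\<forall>j < ?k. \<not> sensed_at G \<sigma> (\<sigma> (Suc i) - 1) j) + ?S"
      using sum0[of q] sum1[of q] row[OF q] S
      by (cases "\<sigma> (Suc i) = Suc q"; cases "\<forall>j < ?k. \<not> sensed_at G \<sigma> q j"; simp add: of_bool_def)+
  qed
  show ?thesis
    unfolding esg_system_def Let_def
  proof (intro conjI allI impI)
    fix i assume "i < ?n"
    then show "int (\<sigma> (Suc i)) = (\<Sum>q < ?n. (int q + 1) * of_bool (\<sigma> (Suc i) = Suc q))"
      using place[of i "\<lambda>q. int q + 1"] pos[of i] by simp
  next
    fix q j assume "q < ?n" "j < ?k"
    then show "of_bool (sensed_at G \<sigma> q j) \<le>
        (\<Sum>i < ?n. of_bool (can_sense G (Suc i) (Suc j)) * of_bool (\<sigma> (Suc i) = Suc q) :: int)"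
      "(\<Sum>i < ?n. of_bool (can_sense G (Suc i) (Suc j)) * of_bool (\<sigma> (Suc i) = Suc q)) \<le>
        of_bool (sensed_at G \<sigma> q j) + (\<Sum>j' < ?k. of_bool (j' < j) * of_bool (sensed_at G \<sigma> q j')) +
        (\<Sum>q' < ?n. of_bool (blocks G q' q) * of_bool (sensed_at G \<sigma> q' j) :: int)"
      unfolding can_sense_target_at[OF \<open>q < ?n\<close>] by (rule upper lower; assumption)+
  qed (rule b01 one col row window missed; assumption)+
qed

end

section \<open>From solutions to orderings\<close>

context
  fixes G s u p y
  assumes sys: "esg_system G s u p y"
begin

private lemma bins:
  assumes "i < num_targets G"
  shows "u i \<in> {0, 1}" "q < num_targets G \<Longrightarrow> p i q \<in> {0, 1}" "j < num_sensors G \<Longrightarrow> y i j \<in> {0, 1}"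
  using sys assms unfolding esg_system_def Let_def by blast+

private lemma placed:
  assumes "i < num_targets G"
  shows "\<exists>q < num_targets G. s i = int q + 1 \<and> (\<forall>q' < num_targets G. p i q' = of_bool (q' = q))"
proof -
  let ?n = "num_targets G"
  have "(\<Sum>q < ?n. p i q) = 1" using sys assms unfolding esg_system_def Let_def by blast
  with one_hot[of ?n "p i"] bins(2)[OF assms]
  obtain q where q: "q < ?n" "\<forall>q' < ?n. p i q' = of_bool (q' = q)" by blast
  have "s i = (\<Sum>q' < ?n. (int q' + 1) * p i q')"
    using sys assms unfolding esg_system_def Let_def by blast
  also have "\<dots> = (\<Sum>q' < ?n. if q' = q then int q' + 1 else 0)"
    using q by (intro sum.cong) auto
  finally show ?thesis using q by auto
qed

lemma esg_system_place:
  assumes "i < num_targets G" "q < num_targets G"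
  shows "p i q = of_bool (nat (s i) = Suc q)"
  using placed[OF assms(1)] assms(2) by (auto simp: nat_add_distrib)

text \<open>Two targets with the same position would contribute 2 to one column sum. An injective
  map between finite sets of equal size is a bijection.\<close>

lemma esg_system_target_ordering: "target_ordering G (\<lambda>t. nat (s (t - 1)))" (is "target_ordering G ?\<sigma>")
proof -
  let ?n = "num_targets G"
  have sub: "?\<sigma> ` targets G \<subseteq> {1..?n}"
  proof
    fix v
    assume "v \<in> ?\<sigma> ` targets G"
    then obtain t where t: "t \<in> targets G" "v = ?\<sigma> t" by blast
    then have "t - 1 < ?n" by (auto simp: targets_def)
    from placed[OF this] t show "v \<in> {1..?n}" by auto
  qed
  moreover have inj: "inj_on ?\<sigma> (targets G)"
  proof (rule inj_onI, rule ccontr)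
    fix t t'
    assume t: "t \<in> targets G" "t' \<in> targets G" "?\<sigma> t = ?\<sigma> t'" "t \<noteq> t'"
    then have less: "t - 1 < ?n" "t' - 1 < ?n" "t - 1 \<noteq> t' - 1" by (auto simp: targets_def)
    from placed[OF less(1)] obtain q where q: "q < ?n" "s (t - 1) = int q + 1" by blast
    then have "?\<sigma> t = Suc q" by simp
    then have "p (t - 1) q = 1" "p (t' - 1) q = 1"
      using t(3) less q by (simp_all add: esg_system_place)
    moreover have "p (t - 1) q + p (t' - 1) q \<le> (\<Sum>i < ?n. p i q)"
      using less bins(2)[OF _ q(1)] by (intro pair_le_sum_lessThan) fastforce+
    moreover have "(\<Sum>i < ?n. p i q) \<le> 1" using sys q(1) unfolding esg_system_def Let_def by blast
    ultimately show False by simp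
  qed
  ultimately show ?thesis
    unfolding target_ordering_def bij_betw_def
    using card_subset_eq[OF _ sub] card_image[OF inj] inj by (simp add: targets_def)
qed

text \<open>Induction along the recursion of \<open>sensed_at\<close>. If all its conditions hold,
  both obstacle sums vanish by induction and the lower bound forces 1. If one fails, the constraint
  belonging to it forces 0.\<close>

lemma esg_system_sense:
  assumes "q < num_targets G" "j < num_sensors G"
  shows "y q j = of_bool (sensed_at G (\<lambda>t. nat (s (t - 1))) q j)"
  using assms
proof (induction "q + j" arbitrary: q j rule: less_induct)
  case less
  let ?n = "num_targets G" and ?k = "num_sensors G" and ?\<sigma> = "\<lambda>t. nat (s (t - 1))"
  let ?S1 = "\<Sum>j' < ?k. of_bool (j' < j) * y q j'" and ?S2 = "\<Sum>q' < ?n. of_bool (blocks G q' q) * y q' j"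
  have "(\<Sum>i < ?n. of_bool (can_sense G (Suc i) (Suc j)) * p i q) =
      (\<Sum>i < ?n. of_bool (can_sense G (Suc i) (Suc j)) * of_bool (?\<sigma> (Suc i) = Suc q))"
    using less.prems by (intro sum.cong) (simp_all add: esg_system_place)
  also have "\<dots> = of_bool (can_sense G (target_at G ?\<sigma> q) (Suc j))"
    by (rule can_sense_target_at[OF esg_system_target_ordering less.prems(1)])
  finally have E: "(\<Sum>i < ?n. of_bool (can_sense G (Suc i) (Suc j)) * p i q) =
      of_bool (can_sense G (target_at G ?\<sigma> q) (Suc j))" .
  have ineq: "y q j \<le> of_bool (can_sense G (target_at G ?\<sigma> q) (Suc j))" "y q j + ?S2 \<le> 1"
    "of_bool (can_sense G (target_at G ?\<sigma> q) (Suc j)) \<le> y q j + ?S1 + ?S2" "(\<Sum>j < ?k. y q j) \<le> 1"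
    using sys less.prems unfolding esg_system_def Let_def E[symmetric] by blast+
  have y01: "y q j \<in> {0, 1}" using bins(3) less.prems by blast
  have IH1: "y q j' = of_bool (sensed_at G ?\<sigma> q j')" if "j' < j" for j'
    using less that by simp
  have IH2: "y q' j = of_bool (sensed_at G ?\<sigma> q' j)" if "blocks G q' q" for q'
    using less that by (simp add: blocks_def)
  note iff = sensed_at_iff[OF esg_system_target_ordering less.prems]
  show ?case
  proof (cases "sensed_at G ?\<sigma> q j")
    case True
    then have S: "?S1 = 0" "?S2 = 0"
      using iff IH1 IH2 by (auto intro!: sum.neutral)
    have "can_sense G (target_at G ?\<sigma> q) (Suc j)" using True iff by blast
    with ineq(3) S y01 True show ?thesis by auto
  next
    case False
    then consider "\<not> can_sense G (target_at G ?\<sigma> q) (Suc j)"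
      | j' where "j' < j" "sensed_at G ?\<sigma> q j'"
      | q' where "q' < ?n" "blocks G q' q" "sensed_at G ?\<sigma> q' j"
      using iff by blast
    then have "y q j = 0"
    proof cases
      case 1
      with ineq(1) y01 show ?thesis by auto
    next
      case 2
      \<comment> \<open>The smaller sensor \<open>j'\<close> already uses up the sum over all
        sensors at position \<open>q\<close>, which is at most 1.\<close>
      have "y q j' + y q j \<le> (\<Sum>j < ?k. y q j)"
        using 2 less.prems bins(3)[OF less.prems(1)] by (intro pair_le_sum_lessThan) fastforce+
      with ineq(4) IH1[OF 2(1)] 2 y01 show ?thesis by auto
    next
      case 3
      have "of_bool (blocks G q' q) * y q' j \<le> ?S2"
        using 3(1) bins(3)[OF _ less.prems(2)] by (intro member_le_sum_lessThan) fastforce+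
      with ineq(2) IH2[OF 3(2)] 3 y01 show ?thesis by auto
    qed
    with False show ?thesis by simp
  qed
qed

lemma esg_system_missed:
  assumes i: "i < num_targets G"
  shows "u i = of_bool (\<forall>j < num_sensors G. \<not> sensed_at G (\<lambda>t. nat (s (t - 1))) (nat (s i) - 1) j)"
proof -
  let ?k = "num_sensors G" and ?\<sigma> = "\<lambda>t. nat (s (t - 1))"
  from placed[OF i] obtain q where q: "q < num_targets G" "s i = int q + 1" by blast
  then have "p i q = 1" using esg_system_place[OF i q(1)] by simp
  then have ineq: "u i + 1 + (\<Sum>j < ?k. y q j) \<le> 2" "1 \<le> u i + (\<Sum>j < ?k. y q j)"
    using sys i q(1) unfolding esg_system_def Let_def by metis+
  have u01: "u i \<in> {0, 1}" using bins(1)[OF i] .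
  have "nat (s i) - 1 = q" using q(2) by simp
  moreover have "u i = of_bool (\<forall>j < ?k. \<not> sensed_at G ?\<sigma> q j)"
  proof (cases "\<forall>j < ?k. \<not> sensed_at G ?\<sigma> q j")
    case True
    then have "(\<Sum>j < ?k. y q j) = 0" using esg_system_sense[OF q(1)] by (intro sum.neutral) auto
    with ineq u01 True show ?thesis by auto
  next
    case False
    then obtain j where j: "j < ?k" "sensed_at G ?\<sigma> q j" by blast
    have "y q j \<le> (\<Sum>j < ?k. y q j)"
      using j bins(3)[OF q(1)] by (intro member_le_sum_lessThan) fastforce+
    with ineq u01 False j esg_system_sense[OF q(1) j(1)] show ?thesis by auto
  qed
  ultimately show ?thesis by simp
qed

end

section \<open>Feasible and optimal solutions against orderings and their values\<close>

lemma esg_ilp_objective: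
  assumes "feasible (esg_ilp G) x"
  shows "target_ordering G (decode_ordering x)"
    and "objective_value (esg_ilp G) x = plan_value G (greedy_plan G (decode_ordering x))"
proof -
  have sys: "esg_system G (\<lambda>i. x ! position_var i) (\<lambda>i. x ! missed_var G i)
       (\<lambda>i q. x ! place_var G i q) (\<lambda>q j. x ! sense_var G q j)"
    using assms by (simp add: feasible_esg_ilp_iff)
  have dec: "decode_ordering x = (\<lambda>t. nat (x ! position_var (t - 1)))"
    by (simp add: fun_eq_iff decode_ordering_def)
  show ord: "target_ordering G (decode_ordering x)"
    unfolding dec by (rule esg_system_target_ordering[OF sys])
  show "objective_value (esg_ilp G) x = plan_value G (greedy_plan G (decode_ordering x))"
    unfolding objective_value_esg_ilp plan_value_eq[OF ord]
    using esg_system_missed[OF sys] by (intro sum.cong) (simp_all add: dec)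
qed

lemma esg_ilp_complete:
  assumes "target_ordering G \<sigma>"
  shows "\<exists>x. feasible (esg_ilp G) x \<and> (\<forall>t \<in> targets G. decode_ordering x t = \<sigma> t)"
  using feasible_solution[OF esg_system_ordering[OF assms]]
  by (intro exI conjI) (auto simp: decode_ordering_def targets_def)

lemma formulates_esg_ilp: "formulates (esg_ilp G) decode_ordering G"
proof -
  let ?v = "\<lambda>\<sigma>. plan_value G (greedy_plan G \<sigma>)"
  have "optimal (esg_ilp G) x \<longleftrightarrow> best_blue_response G (decode_ordering x)" if x: "feasible (esg_ilp G) x" for x
  proof
    assume opt: "optimal (esg_ilp G) x"
    \<comment> \<open>Optimality compares with feasible solutions only, so the competing ordering is
      encoded before its value can be compared.\<close>
    have "?v \<sigma> \<le> ?v (decode_ordering x)" if "target_ordering G \<sigma>" for \<sigma>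
    proof -
      from esg_ilp_complete[OF that] obtain z where
        z: "feasible (esg_ilp G) z" "\<forall>t \<in> targets G. decode_ordering z t = \<sigma> t" by blast
      have "?v \<sigma> = ?v (decode_ordering z)" using greedy_plan_cong[OF z(2)] by simp
      also have "\<dots> \<le> ?v (decode_ordering x)"
        using opt z(1) x unfolding optimal_def by (metis esg_ilp_objective(2))
      finally show ?thesis .
    qed
    then show "best_blue_response G (decode_ordering x)"
      using esg_ilp_objective(1)[OF x] by (simp add: best_blue_response_def)
  next
    assume "best_blue_response G (decode_ordering x)"
    then show "optimal (esg_ilp G) x"
      using x esg_ilp_objective unfolding optimal_def best_blue_response_def by metis
  qed
  then show ?thesis
    unfolding formulates_def using wf_esg_ilp esg_ilp_objective esg_ilp_complete by blast
qed

section \<open>Loop programs\<close>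

text \<open>In \<open>Scale c e\<close> and \<open>For c p\<close>, the factor and the number of iterations are read from the input
  cell \<open>c\<close>. Since these cells cannot be modified, running times are polynomial as soon as their values are.\<close>

datatype expr =
    Lit int
  | Var nat
  | Cell expr
  | Add expr expr
  | Sub expr expr
  | Scale nat expr
  | Ite expr expr expr

datatype prog =
    Stop
  | Emit expr
  | EmitCell expr
  | Cat prog prog (infixr "\<triangleright>" 60)
  | For nat prog

fun eval_expr :: "cell list \<Rightarrow> int list \<Rightarrow> expr \<Rightarrow> int" where
  "eval_expr xs vs (Lit z) = z"
| "eval_expr xs vs (Var r) = (if r < length vs then vs ! r else 0)"
| "eval_expr xs vs (Cell e) = num (input_memory xs (eval_expr xs vs e))"
| "eval_expr xs vs (Add e f) = eval_expr xs vs e + eval_expr xs vs f"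
| "eval_expr xs vs (Sub e f) = eval_expr xs vs e - eval_expr xs vs f"
| "eval_expr xs vs (Scale c e) = int (nat (num (input_memory xs (int c)))) * eval_expr xs vs e"
| "eval_expr xs vs (Ite c e f) = (if eval_expr xs vs c > 0 then eval_expr xs vs e else eval_expr xs vs f)"

text \<open>Loop variables are numbered from the outermost loop inwards (de Bruijn levels). Hence
  entering a loop does not renumber them, and variable \<open>r\<close> can stay in register
  \<open>r\<close>.\<close>

fun run :: "cell list \<Rightarrow> int list \<Rightarrow> prog \<Rightarrow> cell list" where
  "run xs vs Stop = []"
| "run xs vs (Emit e) = [Num (eval_expr xs vs e)]"
| "run xs vs (EmitCell e) = [input_memory xs (eval_expr xs vs e)]"
| "run xs vs (Cat p q) = run xs vs p @ run xs vs q"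
| "run xs vs (For c p) =
     concat (map (\<lambda>i. run xs (vs @ [int i]) p) [0..<nat (num (input_memory xs (int c)))])"

text \<open>Register \<^term>\<open>r\<close> lives at the negative address \<^term>\<open>- 1 - int r\<close>, so that the input is
  never overwritten. The first registers hold the loop variables, the others are scratch space.\<close>

abbreviation loc :: "nat \<Rightarrow> aexp" where
  "loc r \<equiv> Const (- 1 - int r)"

abbreviation reg :: "nat \<Rightarrow> aexp" where
  "reg r \<equiv> Mem (loc r)"

text \<open>Here \<open>n\<close> is the number of live loop variables and \<open>d\<close> the
  register of the result; registers below \<open>d\<close> survive, those above are free. A negative
  address would reach a register instead of the input, so \<open>Cell\<close> tests for it and
  yields 0, the default of \<open>input_memory\<close>.\<close>

fun compile_expr :: "nat \<Rightarrow> nat \<Rightarrow> expr \<Rightarrow> com" where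
  "compile_expr n d (Lit z) = Assign (loc d) (Const z)"
| "compile_expr n d (Var r) = Assign (loc d) (if r < n then reg r else Const 0)"
| "compile_expr n d (Cell e) = Seq (compile_expr n d e)
     (IfPos (Plus (reg d) (Const 1)) (Assign (loc d) (Mem (reg d))) (Assign (loc d) (Const 0)))"
| "compile_expr n d (Add e f) = Seq (compile_expr n d e) (Seq (compile_expr n (Suc d) f)
     (Assign (loc d) (Plus (reg d) (reg (Suc d)))))"
| "compile_expr n d (Sub e f) = Seq (compile_expr n d e) (Seq (compile_expr n (Suc d) f)
     (Assign (loc d) (Minus (reg d) (reg (Suc d)))))"
| "compile_expr n d (Scale c e) = Seq (compile_expr n d e)
     (Seq (Assign (loc (d + 1)) (Const 0))
     (Seq (Assign (loc (d + 2)) (Mem (Const (int c))))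
     (Seq (WhilePos (reg (d + 2))
            (Seq (Assign (loc (d + 1)) (Plus (reg (d + 1)) (reg d)))
                 (Assign (loc (d + 2)) (Minus (reg (d + 2)) (Const 1)))))
          (Assign (loc d) (reg (d + 1))))))"
| "compile_expr n d (Ite c e f) =
     Seq (compile_expr n d c) (IfPos (reg d) (compile_expr n d e) (compile_expr n d f))"

fun compile :: "nat \<Rightarrow> prog \<Rightarrow> com" where
  "compile n Stop = Skip"
| "compile n (Emit e) = Seq (compile_expr n n e) (Write (reg n))"
| "compile n (EmitCell e) = Seq (compile_expr n n e)
     (IfPos (Plus (reg n) (Const 1)) (WriteCell (reg n)) (Write (Const 0)))"
| "compile n (Cat p q) = Seq (compile n p) (compile n q)"
| "compile n (For c p) = Seq (Assign (loc n) (Const 0))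
     (WhilePos (Minus (Mem (Const (int c))) (reg n))
       (Seq (compile (Suc n) p) (Assign (loc n) (Plus (reg n) (Const 1)))))"

text \<open>\<open>B\<close> bounds the input cells used as factors. For \<open>Scale\<close>, each
  of at most \<open>B\<close> rounds takes two assignments and a test; the 4 is the last test and
  three assignments outside the loop. For \<open>Ite\<close>, both branches are added, which keeps
  the bound a polynomial in \<open>B\<close>.\<close>

fun expr_cost :: "nat \<Rightarrow> expr \<Rightarrow> nat" where
  "expr_cost B (Lit z) = 1"
| "expr_cost B (Var r) = 1"
| "expr_cost B (Cell e) = expr_cost B e + 2"
| "expr_cost B (Add e f) = expr_cost B e + expr_cost B f + 1"
| "expr_cost B (Sub e f) = expr_cost B e + expr_cost B f + 1"
| "expr_cost B (Scale c e) = expr_cost B e + (3 * B + 4)"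
| "expr_cost B (Ite c e f) = expr_cost B c + expr_cost B e + expr_cost B f + 1"

fun cost :: "nat \<Rightarrow> prog \<Rightarrow> nat" where
  "cost B Stop = 1"
| "cost B (Emit e) = expr_cost B e + 1"
| "cost B (EmitCell e) = expr_cost B e + 2"
| "cost B (Cat p q) = cost B p + cost B q"
| "cost B (For c p) = B * (cost B p + 2) + 2"

fun expr_dims :: "expr \<Rightarrow> nat set" where
  "expr_dims (Lit z) = {}"
| "expr_dims (Var r) = {}"
| "expr_dims (Cell e) = expr_dims e"
| "expr_dims (Add e f) = expr_dims e \<union> expr_dims f"
| "expr_dims (Sub e f) = expr_dims e \<union> expr_dims f"
| "expr_dims (Scale c e) = insert c (expr_dims e)"
| "expr_dims (Ite c e f) = expr_dims c \<union> expr_dims e \<union> expr_dims f"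

fun dims :: "prog \<Rightarrow> nat set" where
  "dims Stop = {}"
| "dims (Emit e) = expr_dims e"
| "dims (EmitCell e) = expr_dims e"
| "dims (Cat p q) = dims p \<union> dims q"
| "dims (For c p) = insert c (dims p)"

text \<open>Every memory in a run of a compiled program has this form, so its state is just a
  register file \<open>\<rho>\<close> and the input is preserved by construction.\<close>

definition mem :: "cell list \<Rightarrow> (nat \<Rightarrow> int) \<Rightarrow> int \<Rightarrow> cell" where
  "mem xs \<rho> a = (if a < 0 then Num (\<rho> (nat (- 1 - a))) else input_memory xs a)"

lemma mem_reg [simp]: "mem xs \<rho> (- 1 - int r) = Num (\<rho> r)"
  by (simp add: mem_def)

lemma mem_nonneg [simp]: "a \<ge> 0 \<Longrightarrow> mem xs \<rho> a = input_memory xs a"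
  by (simp add: mem_def)

lemma mem_upd: "(mem xs \<rho>)(- 1 - int r := Num z) = mem xs (\<rho>(r := z))"
  by (auto simp: mem_def fun_eq_iff)

lemma input_memory_eq_mem: "input_memory xs = mem xs (\<lambda>_. 0)"
  by (auto simp: mem_def input_memory_def fun_eq_iff)

section \<open>Correctness and running time of compiled programs\<close>

lemma exec_assign:
  "exec (Assign (loc r) e) (mem xs \<rho>, out) 1 (mem xs (\<rho>(r := aval e (mem xs \<rho>))), out)"
  using exec.Assign[of "loc r" e "mem xs \<rho>" out] by (simp add: mem_upd)

text \<open>Register \<open>d + 2\<close> counts down while \<open>d + 1\<close> collects copies of
  \<open>d\<close>. A counter that is not positive stops at once, which is why \<open>nat\<close>
  appears.\<close>

lemma exec_scale_loop:
  "\<exists>t \<le> 3 * nat (\<rho> (d + 2)) + 1. \<exists>\<rho>'. exec (WhilePos (reg (d + 2))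
       (Seq (Assign (loc (d + 1)) (Plus (reg (d + 1)) (reg d)))
         (Assign (loc (d + 2)) (Minus (reg (d + 2)) (Const 1))))) (mem xs \<rho>, out) t (mem xs \<rho>', out) \<and>
     \<rho>' (d + 1) = \<rho> (d + 1) + int (nat (\<rho> (d + 2))) * \<rho> d \<and> (\<forall>r \<le> d. \<rho>' r = \<rho> r)"
  (is "\<exists>t \<le> _. \<exists>\<rho>'. exec (WhilePos ?e ?c) _ _ _ \<and> _ \<and> _")
proof (induction "nat (\<rho> (d + 2))" arbitrary: \<rho>)
  case 0
  then have "aval ?e (fst (mem xs \<rho>, out)) \<le> 0"
    by (simp del: of_nat_add of_nat_Suc)
  then have "exec (WhilePos ?e ?c) (mem xs \<rho>, out) 1 (mem xs \<rho>, out)"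
    by (rule exec.WhileFalse)
  with 0 show ?case by (intro exI[of _ 1]) (auto simp: 0[symmetric])
next
  case (Suc m)
  define \<rho>1 where "\<rho>1 = \<rho>(d + 1 := \<rho> (d + 1) + \<rho> d, d + 2 := \<rho> (d + 2) - 1)"
  have m: "m = nat (\<rho>1 (d + 2))" using Suc(2) by (simp add: \<rho>1_def)
  have pos: "aval ?e (fst (mem xs \<rho>, out)) > 0"
    using Suc(2) by (simp del: of_nat_add of_nat_Suc)
  have "exec ?c (mem xs \<rho>, out) (1 + 1) (mem xs \<rho>1, out)"
    using exec.Seq[OF exec_assign[of "d + 1" "Plus (reg (d + 1)) (reg d)" xs \<rho> out]
        exec_assign[of "d + 2" "Minus (reg (d + 2)) (Const 1)"]]
    by (simp add: \<rho>1_def del: of_nat_add of_nat_Suc add_2_eq_Suc')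
  from Suc(1)[of \<rho>1, OF m] obtain t \<rho>' where
    t: "t \<le> 3 * nat (\<rho>1 (d + 2)) + 1" and
    ex: "exec (WhilePos ?e ?c) (mem xs \<rho>1, out) t (mem xs \<rho>', out)" and
    r: "\<rho>' (d + 1) = \<rho>1 (d + 1) + int (nat (\<rho>1 (d + 2))) * \<rho>1 d" "\<forall>r \<le> d. \<rho>' r = \<rho>1 r"
    by blast
  have \<rho>: "nat (\<rho> (d + 2)) = Suc (nat (\<rho>1 (d + 2)))"
    using Suc(2) m by simp
  have "exec (WhilePos ?e ?c) (mem xs \<rho>, out) (1 + 1 + t + 1) (mem xs \<rho>', out)"
    by (rule exec.WhileTrue) fact+
  moreover have "\<rho>' (d + 1) = \<rho> (d + 1) + int (nat (\<rho> (d + 2))) * \<rho> d"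
    unfolding r(1) \<rho> by (simp add: \<rho>1_def algebra_simps)
  moreover have "\<forall>r \<le> d. \<rho>' r = \<rho> r" using r(2) by (simp add: \<rho>1_def)
  moreover have "1 + 1 + t + 1 \<le> 3 * nat (\<rho> (d + 2)) + 1" using t unfolding \<rho> by simp
  ultimately show ?case by blast
qed

lemma exec_exprI:
  assumes "exec c s t (mem xs \<rho>', out)" "t \<le> T" "\<rho>' d = v" "\<forall>r < d. \<rho>' r = \<rho> r"
  shows "\<exists>t \<le> T. \<exists>\<rho>'. exec c s t (mem xs \<rho>', out) \<and> \<rho>' d = v \<and> (\<forall>r < d. \<rho>' r = \<rho> r)"
  using assms by blast

text \<open>Preservation of the registers below \<open>d\<close> is what makes the induction work:
  the second operand is evaluated at \<open>Suc d\<close> and leaves the first one in place.\<close>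

lemma exec_compile_expr:
  assumes "\<forall>c \<in> expr_dims e. num (input_memory xs (int c)) \<le> int B"
    and "\<forall>r < length vs. \<rho> r = vs ! r" and "length vs \<le> d"
  shows "\<exists>t \<le> expr_cost B e. \<exists>\<rho>'. exec (compile_expr (length vs) d e) (mem xs \<rho>, out) t (mem xs \<rho>', out) \<and>
    \<rho>' d = eval_expr xs vs e \<and> (\<forall>r < d. \<rho>' r = \<rho> r)"
  using assms
proof (induction e arbitrary: \<rho> d)
  case (Lit z)
  show ?case
    by (simp only: compile_expr.simps, rule exec_exprI[OF exec_assign]) auto
next
  case (Var r)
  then show ?case
    by (simp only: compile_expr.simps, intro exec_exprI[OF exec_assign]) auto
next
  case (Cell e)
  obtain t \<rho>1 where t: "t \<le> expr_cost B e"
    and ex: "exec (compile_expr (length vs) d e) (mem xs \<rho>, out) t (mem xs \<rho>1, out)"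
    and \<rho>1: "\<rho>1 d = eval_expr xs vs e" "\<forall>r < d. \<rho>1 r = \<rho> r"
    using Cell.IH[of \<rho> d] Cell.prems by auto
  let ?v = "num (input_memory xs (\<rho>1 d))"
  have "exec (IfPos (Plus (reg d) (Const 1)) (Assign (loc d) (Mem (reg d))) (Assign (loc d) (Const 0)))
      (mem xs \<rho>1, out) (1 + 1) (mem xs (\<rho>1(d := ?v)), out)"
  proof (cases "\<rho>1 d \<ge> 0")
    case True
    then show ?thesis using exec_assign[of d "Mem (reg d)" xs \<rho>1 out]
      by (intro exec.IfTrue) auto
  next
    case False
    then show ?thesis using exec_assign[of d "Const 0" xs \<rho>1 out]
      by (intro exec.IfFalse) (auto simp: input_memory_def)
  qed
  from exec.Seq[OF ex this] show ?case
    by (simp only: compile_expr.simps, rule exec_exprI) (use t \<rho>1 in auto)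
next
  case (Add e f)
  obtain t \<rho>1 where t: "t \<le> expr_cost B e"
    and ex: "exec (compile_expr (length vs) d e) (mem xs \<rho>, out) t (mem xs \<rho>1, out)"
    and \<rho>1: "\<rho>1 d = eval_expr xs vs e" "\<forall>r < d. \<rho>1 r = \<rho> r"
    using Add.IH(1)[of \<rho> d] Add.prems by auto
  have "\<forall>r < length vs. \<rho>1 r = vs ! r" "length vs \<le> Suc d" using \<rho>1 Add.prems by auto
  then obtain t2 \<rho>2 where t2: "t2 \<le> expr_cost B f"
    and ex2: "exec (compile_expr (length vs) (Suc d) f) (mem xs \<rho>1, out) t2 (mem xs \<rho>2, out)"
    and \<rho>2: "\<rho>2 (Suc d) = eval_expr xs vs f" "\<forall>r < Suc d. \<rho>2 r = \<rho>1 r"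
    using Add.IH(2)[of \<rho>1 "Suc d"] Add.prems by auto
  from exec.Seq[OF ex exec.Seq[OF ex2 exec_assign[of d "Plus (reg d) (reg (Suc d))"]]]
  show ?case
    by (simp only: compile_expr.simps, rule exec_exprI) (use t t2 \<rho>1 \<rho>2 in \<open>auto simp del: of_nat_Suc\<close>)
next
  case (Sub e f)
  obtain t \<rho>1 where t: "t \<le> expr_cost B e"
    and ex: "exec (compile_expr (length vs) d e) (mem xs \<rho>, out) t (mem xs \<rho>1, out)"
    and \<rho>1: "\<rho>1 d = eval_expr xs vs e" "\<forall>r < d. \<rho>1 r = \<rho> r"
    using Sub.IH(1)[of \<rho> d] Sub.prems by auto
  have "\<forall>r < length vs. \<rho>1 r = vs ! r" "length vs \<le> Suc d" using \<rho>1 Sub.prems by auto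
  then obtain t2 \<rho>2 where t2: "t2 \<le> expr_cost B f"
    and ex2: "exec (compile_expr (length vs) (Suc d) f) (mem xs \<rho>1, out) t2 (mem xs \<rho>2, out)"
    and \<rho>2: "\<rho>2 (Suc d) = eval_expr xs vs f" "\<forall>r < Suc d. \<rho>2 r = \<rho>1 r"
    using Sub.IH(2)[of \<rho>1 "Suc d"] Sub.prems by auto
  from exec.Seq[OF ex exec.Seq[OF ex2 exec_assign[of d "Minus (reg d) (reg (Suc d))"]]]
  show ?case
    by (simp only: compile_expr.simps, rule exec_exprI) (use t t2 \<rho>1 \<rho>2 in \<open>auto simp del: of_nat_Suc\<close>)
next
  case (Scale c e)
  obtain t \<rho>1 where t: "t \<le> expr_cost B e"
    and ex: "exec (compile_expr (length vs) d e) (mem xs \<rho>, out) t (mem xs \<rho>1, out)"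
    and \<rho>1: "\<rho>1 d = eval_expr xs vs e" "\<forall>r < d. \<rho>1 r = \<rho> r"
    using Scale.IH[of \<rho> d] Scale.prems by auto
  let ?v = "num (input_memory xs (int c))"
  define \<rho>2 where "\<rho>2 = \<rho>1(d + 1 := 0, d + 2 := ?v)"
  have ex1: "exec (Assign (loc (d + 1)) (Const 0)) (mem xs \<rho>1, out) 1 (mem xs (\<rho>1(d + 1 := 0)), out)"
    using exec_assign[of "d + 1" "Const 0" xs \<rho>1 out] by simp
  have ex2: "exec (Assign (loc (d + 2)) (Mem (Const (int c)))) (mem xs (\<rho>1(d + 1 := 0)), out) 1
      (mem xs \<rho>2, out)"
    using exec_assign[of "d + 2" "Mem (Const (int c))" xs "\<rho>1(d + 1 := 0)" out]
    by (simp add: \<rho>2_def)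
  from exec_scale_loop[of \<rho>2 d xs out] obtain t2 \<rho>3 where t2: "t2 \<le> 3 * nat (\<rho>2 (d + 2)) + 1"
    and ex3: "exec (WhilePos (reg (d + 2))
       (Seq (Assign (loc (d + 1)) (Plus (reg (d + 1)) (reg d)))
         (Assign (loc (d + 2)) (Minus (reg (d + 2)) (Const 1))))) (mem xs \<rho>2, out) t2 (mem xs \<rho>3, out)"
    and \<rho>3: "\<rho>3 (d + 1) = \<rho>2 (d + 1) + int (nat (\<rho>2 (d + 2))) * \<rho>2 d" "\<forall>r \<le> d. \<rho>3 r = \<rho>2 r"
    by blast
  have ex4: "exec (Assign (loc d) (reg (d + 1))) (mem xs \<rho>3, out) 1 (mem xs (\<rho>3(d := \<rho>3 (d + 1))), out)"
    using exec_assign[of d "reg (d + 1)" xs \<rho>3 out]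
    by (simp del: of_nat_add of_nat_Suc Suc_eq_plus1 Suc_eq_plus1_left add_Suc_right)
  have "exec (compile_expr (length vs) d (Scale c e)) (mem xs \<rho>, out) (t + (1 + (1 + (t2 + 1))))
      (mem xs (\<rho>3(d := \<rho>3 (d + 1))), out)"
    unfolding compile_expr.simps by (intro exec.Seq[OF ex] exec.Seq[OF ex1] exec.Seq[OF ex2] exec.Seq[OF ex3] ex4)
  moreover have "t + (1 + (1 + (t2 + 1))) \<le> expr_cost B (Scale c e)"
  proof -
    have "nat ?v \<le> B" using Scale.prems(1) by (simp add: nat_le_iff)
    with t t2 show ?thesis by (simp add: \<rho>2_def)
  qed
  moreover have "\<rho>3 (d + 1) = eval_expr xs vs (Scale c e)"
    unfolding \<rho>3(1) using \<rho>1 by (simp add: \<rho>2_def)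
  moreover have "\<forall>r < d. \<rho>3 r = \<rho> r"
    using \<rho>3(2) \<rho>1(2) by (simp add: \<rho>2_def)
  ultimately show ?case using exec_exprI by simp
next
  case (Ite c e f)
  obtain t \<rho>1 where t: "t \<le> expr_cost B c"
    and ex: "exec (compile_expr (length vs) d c) (mem xs \<rho>, out) t (mem xs \<rho>1, out)"
    and \<rho>1: "\<rho>1 d = eval_expr xs vs c" "\<forall>r < d. \<rho>1 r = \<rho> r"
    using Ite.IH(1)[of \<rho> d] Ite.prems by auto
  have eq: "\<forall>r < length vs. \<rho>1 r = vs ! r" using \<rho>1 Ite.prems by auto
  show ?case
  proof (cases "\<rho>1 d > 0")
    case True
    obtain t2 \<rho>2 where t2: "t2 \<le> expr_cost B e"
      and ex2: "exec (compile_expr (length vs) d e) (mem xs \<rho>1, out) t2 (mem xs \<rho>2, out)"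
      and \<rho>2: "\<rho>2 d = eval_expr xs vs e" "\<forall>r < d. \<rho>2 r = \<rho>1 r"
      using Ite.IH(2)[of \<rho>1 d] Ite.prems eq by auto
    have "exec (IfPos (reg d) (compile_expr (length vs) d e) (compile_expr (length vs) d f))
        (mem xs \<rho>1, out) (t2 + 1) (mem xs \<rho>2, out)"
      using ex2 True by (intro exec.IfTrue) auto
    from exec.Seq[OF ex this] show ?thesis
      by (simp only: compile_expr.simps, rule exec_exprI) (use t t2 \<rho>1 \<rho>2 True in auto)
  next
    case False
    obtain t2 \<rho>2 where t2: "t2 \<le> expr_cost B f"
      and ex2: "exec (compile_expr (length vs) d f) (mem xs \<rho>1, out) t2 (mem xs \<rho>2, out)"
      and \<rho>2: "\<rho>2 d = eval_expr xs vs f" "\<forall>r < d. \<rho>2 r = \<rho>1 r"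
      using Ite.IH(3)[of \<rho>1 d] Ite.prems eq by auto
    have "exec (IfPos (reg d) (compile_expr (length vs) d e) (compile_expr (length vs) d f))
        (mem xs \<rho>1, out) (t2 + 1) (mem xs \<rho>2, out)"
      using ex2 False by (intro exec.IfFalse) auto
    from exec.Seq[OF ex this] show ?thesis
      by (simp only: compile_expr.simps, rule exec_exprI) (use t t2 \<rho>1 \<rho>2 False in auto)
  qed
qed

text \<open>Induction on the number of remaining rounds. The body must also preserve register
  \<open>n\<close>, which holds the counter while the body runs; \<open>\<rho>0\<close> records the
  values of the enclosing loop variables.\<close>

lemma exec_for_loop:
  assumes body: "\<And>i \<rho> out. \<lbrakk>i < N; \<rho> n = int i; \<forall>r < n. \<rho> r = \<rho>0 r\<rbrakk> \<Longrightarrow>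
      \<exists>t \<le> C. \<exists>\<rho>'. exec c (mem xs \<rho>, out) t (mem xs \<rho>', out @ f i) \<and> (\<forall>r < Suc n. \<rho>' r = \<rho> r)"
    and N: "N = nat (num (input_memory xs (int b)))"
    and i: "\<rho> n = int i" "\<forall>r < n. \<rho> r = \<rho>0 r" "i \<le> N"
  shows "\<exists>t \<le> (N - i) * (C + 2) + 1. \<exists>\<rho>'.
    exec (WhilePos (Minus (Mem (Const (int b))) (reg n)) (Seq c (Assign (loc n) (Plus (reg n) (Const 1)))))
      (mem xs \<rho>, out) t (mem xs \<rho>', out @ concat (map f [i..<N])) \<and> (\<forall>r < n. \<rho>' r = \<rho>0 r)"
    (is "\<exists>t \<le> _. \<exists>\<rho>'. exec (WhilePos ?e ?c) _ _ _ \<and> _")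
  using i
proof (induction "N - i" arbitrary: i \<rho> out)
  case 0
  then have "aval ?e (fst (mem xs \<rho>, out)) \<le> 0" using N by simp
  then have "exec (WhilePos ?e ?c) (mem xs \<rho>, out) 1 (mem xs \<rho>, out)"
    by (rule exec.WhileFalse)
  with 0 show ?case by (intro exI[of _ 1] exI[of _ \<rho>] conjI) auto
next
  case (Suc m)
  then have "i < N" by simp
  with body[OF this] Suc(3,4) obtain t \<rho>1 where t: "t \<le> C"
    and ex: "exec c (mem xs \<rho>, out) t (mem xs \<rho>1, out @ f i)" and \<rho>1: "\<forall>r < Suc n. \<rho>1 r = \<rho> r"
    by metis
  define \<rho>2 where "\<rho>2 = \<rho>1(n := int (Suc i))"
  have ex1: "exec ?c (mem xs \<rho>, out) (t + 1) (mem xs \<rho>2, out @ f i)"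
    using exec.Seq[OF ex exec_assign[of n "Plus (reg n) (Const 1)"]] \<rho>1 Suc(3)
    by (simp add: \<rho>2_def add.commute)
  have "m = N - Suc i" "\<rho>2 n = int (Suc i)" "\<forall>r < n. \<rho>2 r = \<rho>0 r" "Suc i \<le> N"
    using Suc \<rho>1 \<open>i < N\<close> by (auto simp: \<rho>2_def)
  from Suc(1)[OF this, of "out @ f i"] obtain t2 \<rho>3 where t2: "t2 \<le> (N - Suc i) * (C + 2) + 1"
    and ex2: "exec (WhilePos ?e ?c) (mem xs \<rho>2, out @ f i) t2
      (mem xs \<rho>3, (out @ f i) @ concat (map f [Suc i..<N]))" and \<rho>3: "\<forall>r < n. \<rho>3 r = \<rho>0 r"
    by blast
  have "aval ?e (fst (mem xs \<rho>, out)) > 0" using N \<open>i < N\<close> Suc(3) by simp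
  from exec.WhileTrue[OF this ex1 ex2]
  have "exec (WhilePos ?e ?c) (mem xs \<rho>, out) (t + 1 + t2 + 1)
      (mem xs \<rho>3, out @ concat (map f [i..<N]))"
    using \<open>i < N\<close> by (simp add: upt_conv_Cons)
  moreover have "N - i = Suc (N - Suc i)" using \<open>i < N\<close> by simp
  then have "t + 1 + t2 + 1 \<le> (N - i) * (C + 2) + 1" using t t2 by simp
  ultimately show ?case using \<rho>3 by blast
qed

lemma exec_compile:
  assumes "\<forall>c \<in> dims p. num (input_memory xs (int c)) \<le> int B"
    and "\<forall>r < length vs. \<rho> r = vs ! r"
  shows "\<exists>t \<le> cost B p. \<exists>\<rho>'. exec (compile (length vs) p) (mem xs \<rho>, out) t
      (mem xs \<rho>', out @ run xs vs p) \<and> (\<forall>r < length vs. \<rho>' r = \<rho> r)"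
  using assms
proof (induction p arbitrary: \<rho> vs out)
  case Stop
  show ?case using exec.Skip by (intro exI[of _ 1]) auto
next
  case (Emit e)
  then obtain t \<rho>1 where t: "t \<le> expr_cost B e"
    and ex: "exec (compile_expr (length vs) (length vs) e) (mem xs \<rho>, out) t (mem xs \<rho>1, out)"
    and \<rho>1: "\<rho>1 (length vs) = eval_expr xs vs e" "\<forall>r < length vs. \<rho>1 r = \<rho> r"
    using exec_compile_expr[of e xs B vs \<rho> "length vs" out] by auto
  from exec.Seq[OF ex exec.Write[of "reg (length vs)"]] show ?case using t \<rho>1
    by (intro exI[of _ "t + 1"] conjI exI[of _ \<rho>1]) auto
next
  case (EmitCell e)
  then obtain t \<rho>1 where t: "t \<le> expr_cost B e"
    and ex: "exec (compile_expr (length vs) (length vs) e) (mem xs \<rho>, out) t (mem xs \<rho>1, out)"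
    and \<rho>1: "\<rho>1 (length vs) = eval_expr xs vs e" "\<forall>r < length vs. \<rho>1 r = \<rho> r"
    using exec_compile_expr[of e xs B vs \<rho> "length vs" out] by auto
  let ?n = "length vs"
  have "exec (IfPos (Plus (reg ?n) (Const 1)) (WriteCell (reg ?n)) (Write (Const 0))) (mem xs \<rho>1, out) (1 + 1)
     (mem xs \<rho>1, out @ [input_memory xs (\<rho>1 ?n)])"
  proof (cases "\<rho>1 ?n \<ge> 0")
    case True
    then show ?thesis using exec.WriteCell[of "reg ?n" "mem xs \<rho>1" out]
      by (intro exec.IfTrue) auto
  next
    case False
    then show ?thesis using exec.Write[of "Const 0" "mem xs \<rho>1" out]
      by (intro exec.IfFalse) (auto simp: input_memory_def)
  qed
  from exec.Seq[OF ex this] show ?case using t \<rho>1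
    by (intro exI[of _ "t + (1 + 1)"] conjI exI[of _ \<rho>1]) auto
next
  case (Cat p q)
  obtain t \<rho>1 where t: "t \<le> cost B p"
    and ex: "exec (compile (length vs) p) (mem xs \<rho>, out) t (mem xs \<rho>1, out @ run xs vs p)"
    and \<rho>1: "\<forall>r < length vs. \<rho>1 r = \<rho> r"
    using Cat.IH(1)[of vs \<rho> out] Cat.prems by auto
  then have "\<forall>r < length vs. \<rho>1 r = vs ! r" using Cat.prems by simp
  moreover have "\<forall>c \<in> dims q. num (input_memory xs (int c)) \<le> int B" using Cat.prems by simp
  ultimately obtain t2 \<rho>2 where t2: "t2 \<le> cost B q"
    and ex2: "exec (compile (length vs) q) (mem xs \<rho>1, out @ run xs vs p) t2
      (mem xs \<rho>2, (out @ run xs vs p) @ run xs vs q)"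
    and \<rho>2: "\<forall>r < length vs. \<rho>2 r = \<rho>1 r"
    using Cat.IH(2) by blast
  from exec.Seq[OF ex ex2] show ?case using t t2 \<rho>1 \<rho>2
    by (intro exI[of _ "t + t2"] conjI exI[of _ \<rho>2]) auto
next
  case (For b p)
  let ?n = "length vs" and ?N = "nat (num (input_memory xs (int b)))"
  have 1: "exec (Assign (loc ?n) (Const 0)) (mem xs \<rho>, out) 1 (mem xs (\<rho>(?n := 0)), out)"
    using exec_assign[of ?n "Const 0" xs \<rho> out] by simp
  have "\<exists>t \<le> (?N - 0) * (cost B p + 2) + 1. \<exists>\<rho>'.
    exec (WhilePos (Minus (Mem (Const (int b))) (reg ?n))
        (Seq (compile (Suc ?n) p) (Assign (loc ?n) (Plus (reg ?n) (Const 1)))))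
      (mem xs (\<rho>(?n := 0)), out) t
      (mem xs \<rho>', out @ concat (map (\<lambda>i. run xs (vs @ [int i]) p) [0..<?N])) \<and>
      (\<forall>r < ?n. \<rho>' r = \<rho> r)"
  proof (rule exec_for_loop)
    fix i \<rho>' out
    assume "\<rho>' ?n = int i" "\<forall>r < ?n. \<rho>' r = \<rho> r"
    then have "\<forall>r < length (vs @ [int i]). \<rho>' r = (vs @ [int i]) ! r"
      using For.prems by (auto simp: nth_append less_Suc_eq)
    from For.IH[OF _ this, of out]
    show "\<exists>t\<le>cost B p. \<exists>\<rho>''. exec (compile (Suc ?n) p) (mem xs \<rho>', out) t
        (mem xs \<rho>'', out @ run xs (vs @ [int i]) p) \<and> (\<forall>r<Suc ?n. \<rho>'' r = \<rho>' r)"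
      using For.prems by simp
  qed auto
  then obtain t \<rho>' where t: "t \<le> ?N * (cost B p + 2) + 1" and
    2: "exec (WhilePos (Minus (Mem (Const (int b))) (reg ?n))
        (Seq (compile (Suc ?n) p) (Assign (loc ?n) (Plus (reg ?n) (Const 1)))))
      (mem xs (\<rho>(?n := 0)), out) t
      (mem xs \<rho>', out @ concat (map (\<lambda>i. run xs (vs @ [int i]) p) [0..<?N]))" and
    \<rho>': "\<forall>r < ?n. \<rho>' r = \<rho> r"
    by auto
  have "?N \<le> B" using For.prems by (simp add: nat_le_iff)
  then have "?N * (cost B p + 2) \<le> B * (cost B p + 2)" by (rule mult_le_mono1)
  with t exec.Seq[OF 1 2] \<rho>' show ?case
    by (intro exI[of _ "1 + t"] conjI exI[of _ \<rho>']) auto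
qed

section \<open>Polynomial bounds for the costs\<close>

definition poly_bounded :: "(nat \<Rightarrow> nat) \<Rightarrow> bool" where
  "poly_bounded f \<longleftrightarrow> (\<exists>b e. \<forall>B. f B \<le> b * (B + 1) ^ e)"

lemma poly_bounded_const: "poly_bounded (\<lambda>B. c)"
  unfolding poly_bounded_def by (intro exI[of _ c] exI[of _ 0]) simp

lemma poly_bounded_id: "poly_bounded (\<lambda>B. B)"
  unfolding poly_bounded_def by (intro exI[of _ 1]) simp

text \<open>The base \<open>B + 1\<close> is at least 1 even for \<open>B = 0\<close>, so both
  powers may be raised to the exponent \<open>e + e'\<close>.\<close>

lemma poly_bounded_add:
  assumes "poly_bounded f" "poly_bounded g"
  shows "poly_bounded (\<lambda>B. f B + g B)"
proof -
  from assms obtain b e b' e' where fg: "\<And>B. f B \<le> b * (B + 1) ^ e" "\<And>B. g B \<le> b' * (B + 1) ^ e'"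
    unfolding poly_bounded_def by blast
  have "f B + g B \<le> (b + b') * (B + 1) ^ (e + e')" for B
  proof -
    have "b * (B + 1) ^ e \<le> b * (B + 1) ^ (e + e')" "b' * (B + 1) ^ e' \<le> b' * (B + 1) ^ (e + e')"
      by (intro mult_le_mono2 power_increasing; simp)+
    with fg[of B] show ?thesis unfolding distrib_right by linarith
  qed
  then show ?thesis unfolding poly_bounded_def by blast
qed

lemma poly_bounded_mult:
  assumes "poly_bounded f" "poly_bounded g"
  shows "poly_bounded (\<lambda>B. f B * g B)"
proof -
  from assms obtain b e b' e' where fg: "\<And>B. f B \<le> b * (B + 1) ^ e" "\<And>B. g B \<le> b' * (B + 1) ^ e'"
    unfolding poly_bounded_def by blast
  have "f B * g B \<le> (b * b') * (B + 1) ^ (e + e')" for B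
    using mult_le_mono[OF fg(1)[of B] fg(2)[of B]] by (simp add: power_add mult_ac)
  then show ?thesis unfolding poly_bounded_def by blast
qed

lemmas poly_bounded_intros = poly_bounded_const poly_bounded_id poly_bounded_add poly_bounded_mult

lemma poly_bounded_expr_cost: "poly_bounded (\<lambda>B. expr_cost B e)"
  by (induction e) (simp_all only: expr_cost.simps; intro poly_bounded_intros; assumption)+

lemma poly_bounded_cost: "poly_bounded (\<lambda>B. cost B p)"
  by (induction p) (simp_all only: cost.simps; intro poly_bounded_intros poly_bounded_expr_cost; assumption?)+

text \<open>For positive \<open>B\<close>, \<open>B + 1\<close> is at most \<open>2 * B\<close>,
  whence the factor \<open>2 ^ e\<close>; the additive constant takes care of
  \<open>B = 0\<close>.\<close>

lemma poly_bounded_imp_le: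
  assumes "poly_bounded f"
  shows "\<exists>c d. \<forall>B. f B \<le> c * B ^ d + c"
proof -
  from assms obtain b e where f: "\<And>B. f B \<le> b * (B + 1) ^ e" unfolding poly_bounded_def by blast
  have "f B \<le> (b * 2 ^ e) * B ^ e + b * 2 ^ e" for B
  proof (cases B)
    case 0
    then show ?thesis using f[of 0] le_trans[of "f 0" b "b * 2 ^ e"] by (simp add: trans_le_add2)
  next
    case (Suc m)
    have "f B \<le> b * (B + 1) ^ e" by (rule f)
    also have "\<dots> \<le> b * (2 * B) ^ e" using Suc by (intro mult_le_mono2 power_mono) auto
    finally show ?thesis by (simp add: power_mult_distrib)
  qed
  then show ?thesis by blast
qed

text \<open>The constants come from the cost of \<open>p\<close> alone, so one machine and one
  polynomial serve all inputs; the input length takes the place of \<open>B\<close>.\<close>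

lemma poly_time_on_run:
  assumes dims: "\<And>x c. x \<in> X \<Longrightarrow> c \<in> dims p \<Longrightarrow> num (input_memory (enc x) (int c)) \<le> int (length (enc x))"
    and res: "\<And>x. x \<in> X \<Longrightarrow> run (enc x) [] p = res x"
  shows "poly_time_on X enc res"
proof -
  obtain c d where cd: "\<And>B. cost B p \<le> c * B ^ d + c"
    using poly_bounded_imp_le[OF poly_bounded_cost[of p]] by blast
  have "\<exists>t \<le> c * length (enc x) ^ d + c. computes (compile 0 p) (enc x) (res x) t" if x: "x \<in> X" for x
  proof -
    obtain t \<rho> where t: "t \<le> cost (length (enc x)) p" and
      "exec (compile 0 p) (mem (enc x) (\<lambda>_. 0), []) t (mem (enc x) \<rho>, run (enc x) [] p)"
      using exec_compile[of p "enc x" "length (enc x)" "[]" "\<lambda>_. 0" "[]"] dims[OF x] by auto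
    then have "computes (compile 0 p) (enc x) (res x) t"
      using res[OF x] unfolding computes_def input_memory_eq_mem by auto
    with le_trans[OF t cd] show ?thesis by blast
  qed
  then show ?thesis unfolding poly_time_on_def by blast
qed

section \<open>Generating the program in polynomial time\<close>

text \<open>A constraint as an element of the encoded list, including the leading marker 1.\<close>

definition constraint_code :: "int linear_form \<times> int \<Rightarrow> cell list" where
  "constraint_code = (\<lambda>(a, b). Num 1 # encode_list (\<lambda>(c, v). [Num c, Num (int v)]) a @ [Num b])"

text \<open>Input cells 0, 1 and 2 hold the number of targets, the number of sensors and the
  recharging time; the target values start at cell 3 and the sensing matrix follows row by
  row.\<close>

definition num_targets_expr :: expr where
  "num_targets_expr = Cell (Lit 0)"

definition missed_expr :: "expr \<Rightarrow> expr" where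
  "missed_expr i = Add num_targets_expr i"

definition place_expr :: "expr \<Rightarrow> expr \<Rightarrow> expr" where
  "place_expr i q = Add (Add num_targets_expr num_targets_expr) (Add (Scale 0 i) q)"

definition sense_expr :: "expr \<Rightarrow> expr \<Rightarrow> expr" where
  "sense_expr q j = Add (Add (Add num_targets_expr num_targets_expr) (Scale 0 num_targets_expr)) (Add (Scale 1 q) j)"

definition capable_expr :: "expr \<Rightarrow> expr \<Rightarrow> expr" where
  "capable_expr i j = Cell (Add (Add (Lit 3) num_targets_expr) (Add (Scale 1 i) j))"

definition less_expr :: "expr \<Rightarrow> expr \<Rightarrow> expr" where
  "less_expr e f = Ite (Sub f e) (Lit 1) (Lit 0)"

text \<open>The inner test recognizes the code -1 of an infinite recharging time. Otherwise a
  distance of at most \<open>r\<close> is tested as less than \<open>r + 1\<close>.\<close>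

definition blocks_expr :: "expr \<Rightarrow> expr \<Rightarrow> expr" where
  "blocks_expr q' q = Ite (Sub q q')
     (Ite (Sub (Lit 0) (Cell (Lit 2))) (Lit 1) (less_expr (Sub q q') (Add (Cell (Lit 2)) (Lit 1)))) (Lit 0)"

definition neg_expr :: "expr \<Rightarrow> expr" where
  "neg_expr e = Sub (Lit 0) e"

definition term_prog :: "expr \<Rightarrow> expr \<Rightarrow> prog" where
  "term_prog c v = Emit (Lit 1) \<triangleright> Emit c \<triangleright> Emit v"

definition constraint_prog :: "prog \<Rightarrow> int \<Rightarrow> prog" where
  "constraint_prog p b = Emit (Lit 1) \<triangleright> p \<triangleright> Emit (Lit 0) \<triangleright> Emit (Lit b)"

definition order_prog :: prog where
  "order_prog =
     constraint_prog (For 0 (term_prog (Lit 1) (place_expr (Var 0) (Var 1)))) 1 \<triangleright>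
     constraint_prog (For 0 (term_prog (Lit (- 1)) (place_expr (Var 0) (Var 1)))) (- 1) \<triangleright>
     constraint_prog (For 0 (term_prog (Lit 1) (place_expr (Var 1) (Var 0)))) 1 \<triangleright>
     constraint_prog (term_prog (Lit 1) (Var 0) \<triangleright>
       For 0 (term_prog (Sub (neg_expr (Var 1)) (Lit 1)) (place_expr (Var 0) (Var 1)))) 0 \<triangleright>
     constraint_prog (term_prog (Lit (- 1)) (Var 0) \<triangleright>
       For 0 (term_prog (Add (Var 1) (Lit 1)) (place_expr (Var 0) (Var 1)))) 0 \<triangleright>
     constraint_prog (For 1 (term_prog (Lit 1) (sense_expr (Var 0) (Var 1)))) 1"

definition missed_prog :: prog where
  "missed_prog =
     constraint_prog (term_prog (Lit 1) (missed_expr (Var 0)) \<triangleright>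
       term_prog (Lit 1) (place_expr (Var 0) (Var 1)) \<triangleright>
       For 1 (term_prog (Lit 1) (sense_expr (Var 1) (Var 2)))) 2 \<triangleright>
     constraint_prog (term_prog (Lit (- 1)) (missed_expr (Var 0)) \<triangleright>
       term_prog (Lit 1) (place_expr (Var 0) (Var 1)) \<triangleright>
       For 1 (term_prog (Lit (- 1)) (sense_expr (Var 1) (Var 2)))) 0"

definition sense_prog :: prog where
  "sense_prog =
     constraint_prog (term_prog (Lit 1) (sense_expr (Var 0) (Var 1)) \<triangleright>
       For 0 (term_prog (neg_expr (capable_expr (Var 2) (Var 1))) (place_expr (Var 2) (Var 0)))) 0 \<triangleright>
     constraint_prog (term_prog (Lit 1) (sense_expr (Var 0) (Var 1)) \<triangleright>
       For 0 (term_prog (blocks_expr (Var 2) (Var 0)) (sense_expr (Var 2) (Var 1)))) 1 \<triangleright>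
     constraint_prog (term_prog (Lit (- 1)) (sense_expr (Var 0) (Var 1)) \<triangleright>
       For 0 (term_prog (capable_expr (Var 2) (Var 1)) (place_expr (Var 2) (Var 0))) \<triangleright>
       For 1 (term_prog (neg_expr (less_expr (Var 2) (Var 1))) (sense_expr (Var 0) (Var 2))) \<triangleright>
       For 0 (term_prog (neg_expr (blocks_expr (Var 2) (Var 0))) (sense_expr (Var 2) (Var 1)))) 0"

text \<open>Real numbers occur only in the objective, where \<open>EmitCell\<close> copies them from
  the input. The two outermost \<open>Emit (Lit 0)\<close> end the lists of objective terms and of
  constraints.\<close>

definition ilp_prog :: prog where
  "ilp_prog =
     Emit num_targets_expr \<triangleright>
     Emit (Add (Add num_targets_expr (Scale 0 num_targets_expr)) (Scale 1 num_targets_expr)) \<triangleright>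
     For 0 (Emit (Lit 1) \<triangleright> EmitCell (Add (Lit 3) (Var 0)) \<triangleright> Emit (missed_expr (Var 0))) \<triangleright>
     Emit (Lit 0) \<triangleright>
     For 0 order_prog \<triangleright> For 0 (For 0 missed_prog) \<triangleright> For 0 (For 1 sense_prog) \<triangleright>
     Emit (Lit 0)"

text \<open>The solution follows the encoded instance, and its position variables come
  first.\<close>

definition decode_prog :: prog where
  "decode_prog = For 0 (Emit (Cell
     (Add (Add (Add (Lit 3) num_targets_expr) (Scale 1 num_targets_expr)) (Var 0))))"

section \<open>Reading an encoded instance\<close>

lemma encode_esg_eq:
  "encode_esg G =
     [Num (int (num_targets G)), Num (int (num_sensors G)),
      Num (case recharge G of enat r \<Rightarrow> int r | \<infinity> \<Rightarrow> -1)] @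
     map (\<lambda>i. Val (target_value G (Suc i))) [0..<num_targets G] @
     concat (map (\<lambda>i. map (\<lambda>j. Num (of_bool (can_sense G (Suc i) (Suc j)))) [0..<num_sensors G])
       [0..<num_targets G])"
proof -
  have "[1..<n + 1] = map Suc [0..<n]" for n by (simp add: map_Suc_upt)
  then show ?thesis unfolding encode_esg_def by (simp only: map_map comp_def)
qed

lemma concat_map_upt_cong:
  "(\<And>i. i < m \<Longrightarrow> f i = g i) \<Longrightarrow> concat (map f [0..<m]) = concat (map g [0..<m])"
  by (metis atLeastLessThan_iff map_cong set_upt)

lemma length_encode_esg: "length (encode_esg G) = 3 + num_targets G + num_sensors G * num_targets G"
  by (simp add: encode_esg_eq length_concat_map_upt del: length_concat)

lemma input_memory_nth: "i < length xs \<Longrightarrow> input_memory xs (int i) = xs ! i"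
  by (simp add: input_memory_def)

context
  fixes G zs xs
  defines "xs \<equiv> encode_esg G @ zs"
begin

text \<open>The tail \<open>zs\<close> is empty when the program is printed and holds the solution
  when it is decoded, so both machines share these facts.\<close>

lemma input_dims:
  "input_memory xs 0 = Num (int (num_targets G))" "input_memory xs 1 = Num (int (num_sensors G))"
  "input_memory xs 2 = Num (case recharge G of enat r \<Rightarrow> int r | \<infinity> \<Rightarrow> -1)"
  by (simp_all add: xs_def input_memory_def encode_esg_eq)

lemma input_value:
  assumes "i < num_targets G"
  shows "input_memory xs (3 + int i) = Val (target_value G (Suc i))"
  using assms by (simp add: xs_def input_memory_def encode_esg_eq nth_append nat_add_distrib)

lemma input_capable:
  assumes "i < num_targets G" "j < num_sensors G"
  shows "input_memory xs (3 + int (num_targets G) + (int (num_sensors G) * int i + int j)) =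
    Num (of_bool (can_sense G (Suc i) (Suc j)))"
proof -
  let ?a = "num_sensors G * i + j"
  let ?D = "concat (map (\<lambda>i. map (\<lambda>j. Num (of_bool (can_sense G (Suc i) (Suc j)))) [0..<num_sensors G])
       [0..<num_targets G])"
  have a: "?a < num_sensors G * num_targets G" by (rule mult_add_less[OF assms])
  have "input_memory xs (int (3 + num_targets G + ?a)) = xs ! (3 + num_targets G + ?a)"
    using a by (intro input_memory_nth) (simp add: xs_def length_encode_esg)
  also have "\<dots> = ?D ! ?a"
    using a by (simp add: xs_def encode_esg_eq nth_append length_concat_map_upt del: length_concat)
  finally show ?thesis using assms by (simp add: nth_concat_map_upt)
qed

lemma input_rest:
  assumes "i < length zs"
  shows "input_memory xs (3 + int (num_targets G) + int (num_sensors G) * int (num_targets G) + int i) = zs ! i"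
proof -
  have "input_memory xs (int (length (encode_esg G) + i)) = zs ! i"
    using assms by (subst input_memory_nth) (simp_all add: xs_def)
  then show ?thesis by (simp add: length_encode_esg)
qed

lemma eval_num_targets: "eval_expr xs vs num_targets_expr = int (num_targets G)"
  by (simp add: num_targets_expr_def input_dims)

lemma eval_missed:
  "eval_expr xs vs e = int i \<Longrightarrow> eval_expr xs vs (missed_expr e) = int (missed_var G i)"
  by (simp add: missed_expr_def missed_var_def eval_num_targets)

lemma eval_place:
  "eval_expr xs vs e = int i \<Longrightarrow> eval_expr xs vs f = int q \<Longrightarrow>
    eval_expr xs vs (place_expr e f) = int (place_var G i q)"
  by (simp add: place_expr_def place_var_def eval_num_targets input_dims)

lemma eval_sense:
  "eval_expr xs vs e = int q \<Longrightarrow> eval_expr xs vs f = int j \<Longrightarrow>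
    eval_expr xs vs (sense_expr e f) = int (sense_var G q j)"
  by (simp add: sense_expr_def sense_var_def eval_num_targets input_dims)

lemma eval_capable:
  "eval_expr xs vs e = int i \<Longrightarrow> eval_expr xs vs f = int j \<Longrightarrow> i < num_targets G \<Longrightarrow> j < num_sensors G \<Longrightarrow>
    eval_expr xs vs (capable_expr e f) = of_bool (can_sense G (Suc i) (Suc j))"
  by (simp add: capable_expr_def eval_num_targets input_dims input_capable)

lemma eval_less:
  "eval_expr xs vs e = int i \<Longrightarrow> eval_expr xs vs f = int j \<Longrightarrow>
    eval_expr xs vs (less_expr e f) = of_bool (i < j)"
  by (simp add: less_expr_def)

lemma eval_blocks:
  "eval_expr xs vs e = int q' \<Longrightarrow> eval_expr xs vs f = int q \<Longrightarrow>
    eval_expr xs vs (blocks_expr e f) = of_bool (blocks G q' q)"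
  by (cases "recharge G") (auto simp: blocks_expr_def less_expr_def input_dims blocks_def)

lemma eval_neg: "eval_expr xs vs (neg_expr e) = - eval_expr xs vs e"
  by (simp add: neg_expr_def)

section \<open>Output of the loop programs\<close>

lemma run_For:
  "run xs vs (For 0 p) = concat (map (\<lambda>i. run xs (vs @ [int i]) p) [0..<num_targets G])"
  "run xs vs (For (Suc 0) p) = concat (map (\<lambda>i. run xs (vs @ [int i]) p) [0..<num_sensors G])"
  by (simp_all add: input_dims)

lemma run_term:
  "run xs vs (term_prog c v) = [Num 1, Num (eval_expr xs vs c), Num (eval_expr xs vs v)]"
  by (simp add: term_prog_def)

lemma run_constraint:
  "run xs vs p = concat (map (\<lambda>(c, v). [Num 1, Num c, Num (int v)]) a) \<Longrightarrow>
    run xs vs (constraint_prog p b) = constraint_code (a, b)"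
  by (simp add: constraint_prog_def constraint_code_def encode_list_def case_prod_beta')

lemmas run_eval = run_For run_term eval_missed eval_place eval_sense eval_capable eval_less eval_blocks eval_neg

lemma run_order:
  assumes "i < num_targets G"
  shows "run xs [int i] order_prog = concat (map constraint_code (order_constraints G i))"
  unfolding order_prog_def order_constraints_def Let_def run.simps list.map concat.simps append_Nil2
  by (intro arg_cong2[where f = append] run_constraint)
    (simp_all add: run_eval comp_def position_var_def del: run.simps(5))

lemma run_missed:
  assumes "i < num_targets G" "q < num_targets G"
  shows "run xs [int i, int q] missed_prog = concat (map constraint_code (missed_constraints G i q))"
  unfolding missed_prog_def missed_constraints_def Let_def run.simps list.map concat.simps append_Nil2
  by (intro arg_cong2[where f = append] run_constraint)
    (simp_all add: run_eval comp_def del: run.simps(5))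

lemma run_sense:
  assumes "q < num_targets G" "j < num_sensors G"
  shows "run xs [int q, int j] sense_prog = concat (map constraint_code (sense_constraints G q j))"
  unfolding sense_prog_def sense_constraints_def Let_def run.simps list.map concat.simps append_Nil2
  \<comment> \<open>Matrix entries are read correctly only inside the matrix. The congruence keeps
    the range of the loop variable available for \<open>eval_capable\<close>.\<close>
  by (intro arg_cong2[where f = append] run_constraint; simp add: run_eval comp_def del: run.simps(5))
    (intro concat_map_upt_cong, simp add: eval_capable assms)+

lemma run_ilp_prog: "run xs [] ilp_prog = encode_ilp (esg_ilp G)"
proof -
  let ?n = "num_targets G" and ?k = "num_sensors G"
  have code: "(\<lambda>c. Num 1 # (case c of (a, b) \<Rightarrow> encode_list (\<lambda>(c, j). [Num c, Num (int j)]) a @ [Num b])) =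
      constraint_code"
    by (simp add: constraint_code_def fun_eq_iff)
  have concat_code: "concat (map constraint_code (concat (map f [0..<m]))) =
      concat (map (\<lambda>i. concat (map constraint_code (f i))) [0..<m])" for f :: "nat \<Rightarrow> _" and m
    by (induction m) simp_all
  have obj: "run xs [] (For 0 (Emit (Lit 1) \<triangleright> EmitCell (Add (Lit 3) (Var 0)) \<triangleright> Emit (missed_expr (Var 0)))) =
      concat (map (\<lambda>x. Num 1 # (case x of (c, j) \<Rightarrow> [Val c, Num (int j)])) (objective (esg_ilp G)))"
    by (simp add: run_eval esg_ilp_def Let_def comp_def del: run.simps(5))
      (intro concat_map_upt_cong, simp add: input_value)
  have order: "run xs [] (For 0 order_prog) =
      concat (map constraint_code (concat (map (order_constraints G) [0..<?n])))"
    unfolding run_For concat_code by (intro concat_map_upt_cong) (simp add: run_order)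
  have missed: "run xs [] (For 0 (For 0 missed_prog)) =
      concat (map constraint_code (concat (map (\<lambda>i. concat (map (missed_constraints G i) [0..<?n])) [0..<?n])))"
    unfolding run_For concat_code by (intro concat_map_upt_cong) (simp add: run_missed)
  have sense: "run xs [] (For 0 (For 1 sense_prog)) =
      concat (map constraint_code (concat (map (\<lambda>q. concat (map (sense_constraints G q) [0..<?k])) [0..<?n])))"
    unfolding run_For One_nat_def concat_code by (intro concat_map_upt_cong) (simp add: run_sense)
  have con: "constraints (esg_ilp G) =
       concat (map (order_constraints G) [0..<?n]) @
       concat (map (\<lambda>i. concat (map (missed_constraints G i) [0..<?n])) [0..<?n]) @
       concat (map (\<lambda>q. concat (map (sense_constraints G q) [0..<?k])) [0..<?n])"
    by (simp add: esg_ilp_def Let_def)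
  have enc: "encode_ilp (esg_ilp G) =
      [Num (int ?n), Num (int (?n + ?n * ?n + ?k * ?n))] @
      (concat (map (\<lambda>x. Num 1 # (case x of (c, j) \<Rightarrow> [Val c, Num (int j)])) (objective (esg_ilp G))) @ [Num 0]) @
      concat (map constraint_code (constraints (esg_ilp G))) @ [Num 0]"
    unfolding encode_ilp_def encode_list_def[of _ "constraints _"] encode_list_def[of _ "objective _"] code
    by simp
  have dims: "run xs [] (Emit (Add (Add num_targets_expr (Scale 0 num_targets_expr)) (Scale 1 num_targets_expr))) =
      [Num (int (?n + ?n * ?n + ?k * ?n))]"
    by (simp add: eval_num_targets input_dims)
  show ?thesis
    unfolding enc con ilp_prog_def run.simps(4) obj order missed sense dims
    by (simp add: eval_num_targets)
qed

text \<open>The machine copies integers, whereas \<open>decode_ordering\<close> truncates them by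
  \<open>nat\<close>; for nonnegative entries the two agree.\<close>

lemma run_decode_prog:
  assumes zs: "zs = map Num x" and len: "num_targets G \<le> length x"
    and nonneg: "\<And>i. i < num_targets G \<Longrightarrow> 0 \<le> x ! i"
  shows "run xs [] decode_prog = encode_ordering G (decode_ordering x)"
proof -
  have "run xs [] decode_prog = concat (map (\<lambda>i. [Num (x ! i)]) [0..<num_targets G])"
    using len zs by (simp add: decode_prog_def run_For eval_num_targets input_dims input_rest del: run.simps(5) cong: map_cong)
  also have "\<dots> = map (\<lambda>i. Num (x ! i)) [0..<num_targets G]"
    by (simp add: concat_map_singleton)
  also have "\<dots> = encode_ordering G (decode_ordering x)"
  proof -
    have "[1..<num_targets G + 1] = map Suc [0..<num_targets G]" by (simp add: map_Suc_upt)
    then show ?thesis using nonneg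
      by (simp add: encode_ordering_def decode_ordering_def position_var_def comp_def cong: map_cong)
  qed
  finally show ?thesis .
qed

text \<open>The matrix occupies k n cells, and n is positive, so k is at most the input
  length.\<close>

lemma dims_le_length:
  assumes "is_esg G" "c \<in> {0, 1}"
  shows "num (input_memory xs (int c)) \<le> int (length xs)"
proof -
  have "num_sensors G * 1 \<le> num_sensors G * num_targets G"
    using assms by (intro mult_le_mono2) (simp add: is_esg_def)
  then have "num_targets G \<le> length xs" "num_sensors G \<le> length xs"
    unfolding xs_def length_append length_encode_esg by linarith+
  with assms(2) show ?thesis by (auto simp: input_dims)
qed

end

section \<open>Polynomial time and size\<close>

lemma dims_ilp_prog: "dims ilp_prog \<subseteq> {0, 1}" and dims_decode_prog: "dims decode_prog \<subseteq> {0, 1}"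
  by (simp_all add: ilp_prog_def decode_prog_def order_prog_def missed_prog_def sense_prog_def
      constraint_prog_def term_prog_def num_targets_expr_def missed_expr_def place_expr_def
      sense_expr_def capable_expr_def less_expr_def blocks_expr_def neg_expr_def)

lemma poly_time_encode_ilp: "poly_time_on {G. is_esg G} encode_esg (\<lambda>G. encode_ilp (esg_ilp G))"
proof (rule poly_time_on_run)
  show "num (input_memory (encode_esg G) (int c)) \<le> int (length (encode_esg G))"
    if "G \<in> {G. is_esg G}" "c \<in> dims ilp_prog" for G c
    using dims_le_length[of G c "[]"] that dims_ilp_prog by auto
  show "run (encode_esg G) [] ilp_prog = encode_ilp (esg_ilp G)" for G
    using run_ilp_prog[of G "[]"] by simp
qed

lemma poly_time_decode: "poly_time_on {(G, x). is_esg G \<and> feasible (esg_ilp G) x}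
    (\<lambda>(G, x). encode_esg G @ map Num x) (\<lambda>(G, x). encode_ordering G (decode_ordering x))"
proof (rule poly_time_on_run[where p = decode_prog])
  fix z :: "esg \<times> int list" and c
  assume z: "z \<in> {(G, x). is_esg G \<and> feasible (esg_ilp G) x}"
  obtain G x where Gx: "z = (G, x)" "is_esg G" "feasible (esg_ilp G) x" using z by auto
  show "num (input_memory (case z of (G, x) \<Rightarrow> encode_esg G @ map Num x) (int c)) \<le>
      int (length (case z of (G, x) \<Rightarrow> encode_esg G @ map Num x))" if "c \<in> dims decode_prog"
    using dims_le_length[OF Gx(2), of c "map Num x"] that dims_decode_prog Gx(1) by auto
  \<comment> \<open>A decoded position is at least 1, and \<open>nat\<close> of a negative number
    would be 0.\<close>
  have "0 \<le> x ! i" if i: "i < num_targets G" for i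
  proof -
    have "decode_ordering x (Suc i) \<ge> 1"
      using ordering_range[OF esg_ilp_objective(1)[OF Gx(3)], of "Suc i"] i by (simp add: targets_def)
    then show ?thesis by (simp add: decode_ordering_def position_var_def)
  qed
  moreover have "num_targets G \<le> length x"
    using Gx(3) by (simp add: feasible_def num_vars_esg_ilp)
  ultimately show "run (case z of (G, x) \<Rightarrow> encode_esg G @ map Num x) [] decode_prog =
      (case z of (G, x) \<Rightarrow> encode_ordering G (decode_ordering x))"
    using run_decode_prog[of "map Num x" x G] Gx(1) by simp
qed

lemma length_constraints_esg_ilp:
  "length (constraints (esg_ilp G)) = 6 * num_targets G + 2 * num_targets G * num_targets G +
    3 * num_targets G * num_sensors G"
  by (simp add: esg_ilp_def Let_def length_concat comp_def order_constraints_def missed_constraints_def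
      sense_constraints_def sum_list_triv algebra_simps)

theorem proposition8:
  "\<exists>(F :: esg \<Rightarrow> ilp) (dec :: esg \<Rightarrow> int list \<Rightarrow> nat \<Rightarrow> nat).
     (\<forall>G. is_esg G \<longrightarrow> formulates (F G) (dec G) G) \<and>
     poly_time_on {G. is_esg G} encode_esg (\<lambda>G. encode_ilp (F G)) \<and>
     poly_time_on {(G, x). is_esg G \<and> feasible (F G) x}
       (\<lambda>(G, x). encode_esg G @ map Num x) (\<lambda>(G, x). encode_ordering G (dec G x)) \<and>
     (\<lambda>G. real (num_binary (F G))) \<in>
       O[principal {G. is_esg G}](\<lambda>G. real (num_targets G ^ 2 * num_sensors G)) \<and>
     (\<lambda>G. real (num_integer (F G))) \<in>
       O[principal {G. is_esg G}](\<lambda>G. real (num_targets G)) \<and>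
     (\<lambda>G. real (length (constraints (F G)))) \<in>
       O[principal {G. is_esg G}](\<lambda>G. real (num_targets G ^ 2 * num_sensors G))"
proof (intro exI[of _ esg_ilp] exI[of _ "\<lambda>_. decode_ordering"] conjI allI impI)
  \<comment> \<open>\<open>is_esg\<close> makes n and k positive, so each of these orders of growth
    is absorbed.\<close>
  have le: "num_targets G \<le> num_targets G ^ 2 * num_sensors G"
      "num_targets G * num_targets G \<le> num_targets G ^ 2 * num_sensors G"
      "num_targets G * num_sensors G \<le> num_targets G ^ 2 * num_sensors G" if "is_esg G" for G
    using that by (auto simp: is_esg_def power2_eq_square)
  have bigo: "(\<lambda>G. real (f G)) \<in> O[principal {G. is_esg G}](\<lambda>G. real (g G))"
    if "\<And>G. is_esg G \<Longrightarrow> f G \<le> c * g G" for f g :: "esg \<Rightarrow> nat" and c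
  proof (rule bigoI[where c = "real c"])
    have "real (f G) \<le> real c * real (g G)" if "is_esg G" for G
      using \<open>\<And>G. is_esg G \<Longrightarrow> f G \<le> c * g G\<close>[OF that] by (simp flip: of_nat_mult)
    then show "\<forall>\<^sub>F G in principal {G. is_esg G}. norm (real (f G)) \<le> real c * norm (real (g G))"
      by (simp add: eventually_principal)
  qed
  show "(\<lambda>G. real (num_binary (esg_ilp G))) \<in>
       O[principal {G. is_esg G}](\<lambda>G. real (num_targets G ^ 2 * num_sensors G))"
  \<comment> \<open>One unit for each block of binary variables: missed, place and sense.\<close>
  proof (rule bigo[where c = 3])
    show "num_binary (esg_ilp G) \<le> 3 * (num_targets G ^ 2 * num_sensors G)" if "is_esg G" for G
      using le[OF that] unfolding esg_ilp_simps mult.commute[of "num_sensors G" "num_targets G"] by linarith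
  qed
  show "(\<lambda>G. real (num_integer (esg_ilp G))) \<in> O[principal {G. is_esg G}](\<lambda>G. real (num_targets G))"
    by (intro bigo[where c = 1]) simp
  show "(\<lambda>G. real (length (constraints (esg_ilp G)))) \<in>
       O[principal {G. is_esg G}](\<lambda>G. real (num_targets G ^ 2 * num_sensors G))"
  \<comment> \<open>11 = 6 + 2 + 3, the numbers of constraints per target, per target and position,
    and per position and sensor.\<close>
  proof (rule bigo[where c = 11])
    show "length (constraints (esg_ilp G)) \<le> 11 * (num_targets G ^ 2 * num_sensors G)" if "is_esg G" for G
      using le[OF that] unfolding length_constraints_esg_ilp mult.assoc by linarith
  qed
qed (rule formulates_esg_ilp poly_time_encode_ilp poly_time_decode)+

end
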